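(* For any $n\in\mathbb{N}$, $p\in(1,+\infty)$ and $m\in[p,+\infty)$ there exists $\widehat C_{n,p,m}\in(0,+\infty)$, depending only on $n,p,m$, such that for every $\tau\in(0,+\infty)$ and $s\in(0,1)$, if we define $$\bar R:=\left(\frac{\widehat C_{n,p,m}}{s(1-s)\tau}\right)^{\frac1{ps}},$$ the following holds true. For every $R\in[\bar R,+\infty)$ there exists a rotationally symmetric function $w\in C(\mathbb{R}^n,(-1,1])$ such that $w\equiv1$ in $\mathbb{R}^n\setminus B_R$ and, for every $x\in B_R$, $$-(-\Delta)_p^sw(x)\le\tau(1+w(x))^{m-1}.$$ Also, if we set $q:=\frac{p}{m-1}$ and $$C_{s,\tau,n,p,m}:=2^{q+1}\max\{1,\bar R^{qs}\},$$ then, for every $x\in B_R$, $$1+w(x)\le\frac{C_{s,\tau,n,p,m}}{(1+R-|x|)^{qs}}.$$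
   Context: $B_R$ is the ball of radius $R$ centered at the origin. For measurable $z:\mathbb{R}^n\to\mathbb{R}$ and $x\in\mathbb{R}^n$, $$(-\Delta)_p^sz(x):=\int_{\mathbb{R}^n}\frac{(z(x)-z(y))\,|z(x)-z(y)|^{p-2}}{|x-y|^{n+sp}}\,dy,$$ understood in the principal value sense (with value in the extended reals). *)

theory Defs
  imports "HOL-Analysis.Analysis"
begin

text \<open>
  \<open>has_extended_integral M f I\<close>: \<open>f\<close> has an integral in the extended reals with value \<open>I\<close>. Since
  \<^const>\<open>ennreal\<close> maps negative numbers to 0, the two nonnegative integrals are those of the
  positive and of the negative part of \<open>f\<close>; the case \<open>\<infinity> - \<infinity>\<close>, which has a junk value on
  \<^typ>\<open>ereal\<close>, is excluded.
\<close>

definition has_extended_integral :: "'a measure \<Rightarrow> ('a \<Rightarrow> real) \<Rightarrow> ereal \<Rightarrow> bool" where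
  "has_extended_integral M f I \<longleftrightarrow>
     f \<in> borel_measurable M \<and>
     ((\<integral>\<^sup>+ y. ennreal (f y) \<partial>M) < \<infinity> \<or> (\<integral>\<^sup>+ y. ennreal (- f y) \<partial>M) < \<infinity>) \<and>
     I = enn2ereal (\<integral>\<^sup>+ y. ennreal (f y) \<partial>M) - enn2ereal (\<integral>\<^sup>+ y. ennreal (- f y) \<partial>M)"

text \<open>
  For \<open>p < 2\<close> the factor \<open>\<bar>z x - z y\<bar> powr (p - 2)\<close> is singular where \<open>z x = z y\<close>. There the
  integrand is understood as 0, which holds here because \<open>0 * a = 0\<close>.
\<close>

definition frac_p_integrand :: "real \<Rightarrow> real \<Rightarrow> (real ^ 'n \<Rightarrow> real) \<Rightarrow> real ^ 'n \<Rightarrow> real ^ 'n \<Rightarrow> real" where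
  "frac_p_integrand s p z x y =
     (z x - z y) * \<bar>z x - z y\<bar> powr (p - 2) / norm (x - y) powr (real CARD('n) + s * p)"

text \<open>
  \<open>has_frac_p_laplacian s p z x L\<close>: the principal value defining \<open>(-\<Delta>)\<^sub>p\<^sup>s z(x)\<close>, that is, the limit
  as \<open>\<epsilon> \<rightarrow> 0+\<close> of the integrals over the complement of the ball of radius \<open>\<epsilon>\<close> around \<open>x\<close>, exists
  in the extended reals and equals \<open>L\<close>.
\<close>

definition has_frac_p_laplacian :: "real \<Rightarrow> real \<Rightarrow> (real ^ 'n \<Rightarrow> real) \<Rightarrow> real ^ 'n \<Rightarrow> ereal \<Rightarrow> bool" where
  "has_frac_p_laplacian s p z x L \<longleftrightarrow>
     (\<exists>I. (\<forall>\<epsilon>>0. has_extended_integral (lebesgue_on (- ball x \<epsilon>)) (frac_p_integrand s p z x) (I \<epsilon>)) \<and>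
          (I \<longlongrightarrow> L) (at_right (0::real)))"

text \<open>
  Radial symmetry, i.e. invariance under the full orthogonal group; in dimension 1 this means that
  the function is even.
\<close>

definition rotationally_symmetric :: "(real ^ 'n \<Rightarrow> real) \<Rightarrow> bool" where
  "rotationally_symmetric w \<longleftrightarrow> (\<exists>g. \<forall>x. w x = g (norm x))"

end

theory Submission imports Defs begin

text \<open>
  With \<open>q = p / (m - 1)\<close> and \<open>\<beta> = p / (p - 1)\<close> take \<open>1 + w = 2 min {1, (R0 / E) powr (q s)}\<close>, where
  \<open>R0\<close> is the lower bound for \<open>R\<close> in the statement divided by \<open>\<beta>\<close>, and
  \<open>E = (R / \<beta>) (1 - (\<bar>x\<bar> / R) powr \<beta>)\<close> is comparable to the distance \<open>R - \<bar>x\<bar>\<close> to the sphere. Where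
  \<open>1 + w = 2\<close> the function is maximal and its integrand has the right sign; elsewhere
  \<open>(1 + w) powr (m - 1)\<close> is of order \<open>(R0 / E) powr (p s)\<close>, so that it suffices to bound \<open>-(-\<Delta>)\<^sub>p\<^sup>s w(x)\<close>
  by a constant times \<open>E powr (- p s) / (s (1 - s))\<close>. The part of the integral outside the ball of radius
  \<open>E / 2\<close> around \<open>x\<close> obeys this bound since \<open>w\<close> is bounded. Near \<open>x\<close> the first order terms have
  to cancel. A point \<open>y\<close> with \<open>\<bar>y\<bar> > \<bar>x\<bar>\<close> is paired with its image under the inversion in the
  sphere through \<open>x\<close>: the increments of \<open>w\<close> towards both points then have opposite signs and almost
  the same size, whatever the direction of \<open>y - x\<close>, which avoids angular integrals that are singular
  for \<open>p < 2\<close>. The exponent \<open>\<beta>\<close> makes the \<open>(p - 1)\<close>-st power of the radial derivative of \<open>w\<close>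
  Lipschitz, also at the origin, so the sum over a pair is at most a constant times
  \<open>E powr (- p) \<bar>x - y\<bar> powr p\<close>, which is integrable against the kernel.
  Only this upper bound is needed for the principal value to exist in the extended reals.
\<close>

section \<open>Inversion in a sphere\<close>

text \<open>
  The library's change of variables theorem needs a well-ordered index type, while the index type of
  the theorem is only finite. The type \<open>'a index\<close> is a well-ordered copy of \<open>'a\<close>, along which
  integrals can be transported.
\<close>

typedef ('a::finite) index = "{..<CARD('a)}"
  by (auto intro!: exI[of _ 0] simp: card_gt_0_iff)

instance index :: (finite) finite
proof
  have "range (Rep_index :: 'a index \<Rightarrow> nat) \<subseteq> {..<CARD('a)}"
    using Rep_index by auto
  then have "finite (range (Rep_index :: 'a index \<Rightarrow> nat))"
    using finite_subset by blast
  then show "finite (UNIV :: 'a index set)"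
    by (rule finite_imageD) (auto simp: inj_on_def Rep_index_inject)
qed

instantiation index :: (finite) linorder
begin

definition less_eq_index :: "'a index \<Rightarrow> 'a index \<Rightarrow> bool" where
  "i \<le> j \<longleftrightarrow> Rep_index i \<le> Rep_index j"

definition less_index :: "'a index \<Rightarrow> 'a index \<Rightarrow> bool" where
  "i < j \<longleftrightarrow> Rep_index i < Rep_index j"

instance
  by intro_classes (auto simp: less_eq_index_def less_index_def Rep_index_inject)

end

instance index :: (finite) wellorder
proof -
  have "{(i, j :: 'a index). i < j} = inv_image less_than Rep_index"
    by (auto simp: less_index_def inv_image_def)
  then have "wf {(i, j :: 'a index). i < j}"
    by simp
  then show "OFCLASS('a index, wellorder_class)"
    by (rule wf_wellorderI) intro_classes
qed

lemma card_index [simp]: "CARD(('a::finite) index) = CARD('a)"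
  using type_definition.card[OF type_definition_index[where 'a='a]] by simp

section \<open>The inversion, its distance formula and its derivative\<close>

definition inversion :: "real \<Rightarrow> 'a::real_normed_vector \<Rightarrow> 'a" where
  "inversion \<rho> y = (\<rho>\<^sup>2 / (norm y)\<^sup>2) *\<^sub>R y"

lemma norm_inversion: "norm (inversion \<rho> y) = \<rho>\<^sup>2 / norm y"
  by (auto simp: inversion_def power2_eq_square)

lemma inversion_inversion:
  assumes "y \<noteq> 0" "\<rho> \<noteq> 0"
  shows "inversion \<rho> (inversion \<rho> y) = y"
  using assms unfolding inversion_def[of \<rho> "inversion \<rho> y"] norm_inversion
  by (simp add: inversion_def field_simps power2_eq_square)

text \<open>The inversion in the sphere of radius \<open>norm x\<close> fixes \<open>x\<close>, so
  this is the distance formula for the images of two points under an inversion. It gives the exact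
  factor by which the kernel changes at the partner of \<open>y\<close>.\<close>

lemma norm_diff_inversion:
  fixes x :: "'a::real_inner"
  assumes "y \<noteq> 0" "x \<noteq> 0"
  shows "norm (x - inversion (norm x) y) = norm x / norm y * norm (x - y)"
proof (rule power2_eq_imp_eq)
  have "norm y \<noteq> 0" using assms by simp
  then show "(norm (x - inversion (norm x) y))\<^sup>2 = (norm x / norm y * norm (x - y))\<^sup>2"
    by (simp add: power_mult_distrib power2_norm_eq_inner inner_diff inner_commute inversion_def power_divide)
       (simp add: power2_norm_eq_inner[symmetric] field_simps power2_eq_square)
qed auto

text \<open>A multiple of the reflection in the hyperplane orthogonal to \<open>y\<close>. This form
  displays the conformality of the inversion, which makes the Jacobian determinant a pure power of
  \<open>\<rho> / norm y\<close>.\<close>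

definition inversion_deriv :: "real \<Rightarrow> 'a::real_inner \<Rightarrow> 'a \<Rightarrow> 'a" where
  "inversion_deriv \<rho> y h = (\<rho>\<^sup>2 / (norm y)\<^sup>2) *\<^sub>R (h - (2 * (y \<bullet> h) / (norm y)\<^sup>2) *\<^sub>R y)"

lemma has_derivative_inversion:
  fixes y :: "'a::real_inner"
  assumes "y \<noteq> 0"
  shows "(inversion \<rho> has_derivative inversion_deriv \<rho> y) (at y within S)"
proof -
  have nz: "y \<bullet> y \<noteq> 0" using assms by simp
  have "((\<lambda>y. (\<rho>\<^sup>2 / (y \<bullet> y)) *\<^sub>R y) has_derivative
      (\<lambda>h. (\<rho>\<^sup>2 / (y \<bullet> y)) *\<^sub>R h + (- (\<rho>\<^sup>2 * (y \<bullet> h + h \<bullet> y)) / (y \<bullet> y)\<^sup>2) *\<^sub>R y)) (at y within S)"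
    by (rule derivative_eq_intros refl nz)+ (simp add: divide_simps power2_eq_square)
  moreover have "(\<lambda>h. (\<rho>\<^sup>2 / (y \<bullet> y)) *\<^sub>R h + (- (\<rho>\<^sup>2 * (y \<bullet> h + h \<bullet> y)) / (y \<bullet> y)\<^sup>2) *\<^sub>R y) =
      inversion_deriv \<rho> y"
    unfolding inversion_deriv_def power2_norm_eq_inner
    by (simp add: fun_eq_iff scaleR_diff_right inner_commute power2_eq_square)
  ultimately have "((\<lambda>y. (\<rho>\<^sup>2 / (y \<bullet> y)) *\<^sub>R y) has_derivative inversion_deriv \<rho> y) (at y within S)"
    by simp
  then show ?thesis
    by (simp add: inversion_def[abs_def] power2_norm_eq_inner)
qed

lemma det_inversion_deriv:
  fixes y :: "real^'n"
  assumes "y \<noteq> 0"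
  shows "\<bar>det (matrix (inversion_deriv \<rho> y))\<bar> = (\<bar>\<rho>\<bar> / norm y) ^ (2 * CARD('n))"
proof -
  \<comment> \<open>The reflection is orthogonal, so its determinant has absolute value 1 and only
    the scalar factor counts.\<close>
  define T where "T h = h - (2 * (y \<bullet> h) / (norm y)\<^sup>2) *\<^sub>R y" for h
  have ny: "norm y \<noteq> 0" "y \<bullet> y \<noteq> 0" using assms by auto
  have "linear T"
    unfolding T_def by (rule linearI) (auto simp: algebra_simps inner_simps add_divide_distrib)
  moreover have "T v \<bullet> T w = v \<bullet> w" for v w
    using ny by (simp add: T_def inner_diff inner_commute power2_norm_eq_inner field_simps)
  ultimately have orth: "orthogonal_transformation T"
    by (simp add: orthogonal_transformation_def)
  have "inversion_deriv \<rho> y = (*\<^sub>R) (\<rho>\<^sup>2 / (norm y)\<^sup>2) \<circ> T"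
    by (auto simp: inversion_deriv_def T_def)
  then have "matrix (inversion_deriv \<rho> y) = matrix ((*\<^sub>R) (\<rho>\<^sup>2 / (norm y)\<^sup>2)) ** matrix T"
    using \<open>linear T\<close> by (simp add: matrix_compose linear_scale_self)
  then show ?thesis
    using orth by (simp add: det_mul abs_mult power_abs power_mult power_divide)
qed

lemma inj_on_inversion:
  assumes "0 \<notin> S" "\<rho> \<noteq> 0"
  shows "inj_on (inversion \<rho>) S"
  by (rule inj_on_inverseI[of _ "inversion \<rho>"]) (use assms inversion_inversion in metis)

lemma nn_integral_inversion_wellorder:
  fixes S :: "(real^'m::{finite,wellorder}) set" and f :: "real^'m::_ \<Rightarrow> real"
  assumes S: "S \<in> sets borel" and "0 \<notin> S" "\<rho> \<noteq> 0" and nonneg: "\<And>y. f y \<ge> 0"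
    and int: "f absolutely_integrable_on inversion \<rho> ` S"
  shows "(\<integral>\<^sup>+ y\<in>inversion \<rho> ` S. f y \<partial>lborel) =
    (\<integral>\<^sup>+ y\<in>S. ennreal ((\<bar>\<rho>\<bar> / norm y) ^ (2 * CARD('m)) * f (inversion \<rho> y)) \<partial>lborel)"
proof -
  let ?J = "\<lambda>y :: real^'m::_. (\<bar>\<rho>\<bar> / norm y) ^ (2 * CARD('m))"
  let ?g = "\<lambda>y. \<bar>det (matrix (inversion_deriv \<rho> y))\<bar> * f (inversion \<rho> y)"
  have S': "S \<in> sets lebesgue" using S by auto
  have nz: "y \<noteq> 0" if "y \<in> S" for y using that \<open>0 \<notin> S\<close> by auto
  define b where "b = integral (inversion \<rho> ` S) f"
  \<comment> \<open>The change of variables theorem speaks of vector valued functions, so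
    \<open>f\<close> is wrapped into \<open>real ^ 1\<close> by \<open>vec\<close>. It is an
    equivalence for every value \<open>b\<close>; taking the integral itself as \<open>b\<close>
    makes the right side true.\<close>
  have "(\<lambda>y. \<bar>det (matrix (inversion_deriv \<rho> y))\<bar> *\<^sub>R vec (f (inversion \<rho> y)) :: real ^ 1) absolutely_integrable_on S \<and>
      integral S (\<lambda>y. \<bar>det (matrix (inversion_deriv \<rho> y))\<bar> *\<^sub>R vec (f (inversion \<rho> y))) = (vec b :: real ^ 1)
    \<longleftrightarrow> (\<lambda>y. vec (f y) :: real ^ 1) absolutely_integrable_on (inversion \<rho> ` S) \<and>
      integral (inversion \<rho> ` S) (\<lambda>y. vec (f y)) = (vec b :: real ^ 1)"
    by (rule has_absolute_integral_change_of_variables[OF S' has_derivative_inversion inj_on_inversion])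
       (use assms nz in auto)
  then have "?g absolutely_integrable_on S \<and> integral S ?g = b
    \<longleftrightarrow> f absolutely_integrable_on (inversion \<rho> ` S) \<and> integral (inversion \<rho> ` S) f = b"
    by (simp add: absolutely_integrable_on_1_iff integral_on_1_eq)
  then have *: "?g absolutely_integrable_on S" "integral S ?g = b"
    using int b_def by auto
  have "(\<integral>\<^sup>+ y\<in>inversion \<rho> ` S. f y \<partial>lborel) = ennreal b"
    using int unfolding b_def
    by (intro nn_integral_has_integral_lebesgue' nonneg integrable_integral)
       (simp add: absolutely_integrable_on_def)
  moreover have "(\<integral>\<^sup>+ y\<in>S. ?g y \<partial>lborel) = ennreal b"
    using * by (intro nn_integral_has_integral_lebesgue')
      (auto simp: nonneg absolutely_integrable_on_def has_integral_iff)
  moreover have "(\<integral>\<^sup>+ y\<in>S. ?g y \<partial>lborel) = (\<integral>\<^sup>+ y\<in>S. ennreal (?J y * f (inversion \<rho> y)) \<partial>lborel)"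
    by (intro nn_integral_cong) (auto simp: indicator_def det_inversion_deriv nz)
  ultimately show ?thesis by simp
qed

section \<open>Lebesgue measure under a relabelling of coordinates\<close>

definition reindex :: "('m \<Rightarrow> 'n) \<Rightarrow> real^'n \<Rightarrow> real^'m" where
  "reindex e y = (\<chi> i. y $ e i)"

lemma reindex_scaleR: "reindex e (c *\<^sub>R y) = c *\<^sub>R reindex e y"
  by (simp add: reindex_def vec_eq_iff)

lemma borel_measurable_reindex [measurable]: "reindex e \<in> borel_measurable borel"
  unfolding reindex_def
  by (intro borel_measurable_continuous_onI continuous_intros)

lemma reindex_reindex:
  assumes "bij e"
  shows "reindex (inv e) (reindex e y) = y" "reindex e (reindex (inv e) z) = z"
  using assms by (auto simp: reindex_def vec_eq_iff bij_is_surj surj_f_inv_f bij_is_inj)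

lemma norm_reindex:
  fixes e :: "'m::finite \<Rightarrow> 'n::finite"
  assumes "bij e"
  shows "norm (reindex e y) = norm y"
proof -
  have "(\<Sum>i\<in>UNIV. (y $ e i)\<^sup>2) = (\<Sum>j\<in>UNIV. (y $ j)\<^sup>2)"
    by (rule sum.reindex_bij_betw[OF assms])
  then show ?thesis
    by (simp add: norm_vec_def L2_set_def reindex_def)
qed

lemma reindex_inversion:
  fixes e :: "'m::finite \<Rightarrow> 'n::finite"
  assumes "bij e"
  shows "reindex e (inversion \<rho> y) = inversion \<rho> (reindex e y)"
  by (simp add: inversion_def reindex_scaleR norm_reindex[OF assms])

lemma prod_Basis_vec:
  "(\<Prod>b\<in>Basis. (v :: real^'n) \<bullet> b) = (\<Prod>i\<in>UNIV. v $ i)"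
proof -
  have B: "(Basis :: (real^'n) set) = (\<lambda>i. axis i 1) ` UNIV"
    by (auto simp: Basis_vec_def)
  have "inj (\<lambda>i :: 'n. axis i (1 :: real))"
    by (auto simp: inj_on_def axis_eq_axis)
  then show ?thesis
    unfolding B by (subst prod.reindex) (auto simp: inner_axis)
qed

text \<open>Lebesgue measure is determined by its values on boxes, and relabelling coordinates along
  a bijection permutes the side lengths of a box without changing their product.\<close>

lemma distr_lborel_reindex:
  fixes e :: "'m::finite \<Rightarrow> 'n::finite"
  assumes e: "bij e"
  shows "distr lborel borel (reindex e) = lborel"
proof (rule lborel_eqI[symmetric])
  fix l u :: "real^'m"
  assume le: "\<And>b. b \<in> Basis \<Longrightarrow> l \<bullet> b \<le> u \<bullet> b"
  have le': "l $ i \<le> u $ i" for i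
    using le[of "axis i 1"] by (auto simp: Basis_vec_def inner_axis)
  have surj: "e (inv e j) = j" "inv e (e i) = i" for i j
    using e by (auto simp: bij_is_surj surj_f_inv_f bij_is_inj)
  have "reindex e -` box l u = box (reindex (inv e) l) (reindex (inv e) u)"
    by (auto simp: mem_box_cart reindex_def surj) (metis surj)+
  then have "emeasure (distr lborel borel (reindex e)) (box l u) =
    emeasure lborel (box (reindex (inv e) l) (reindex (inv e) u))"
    by (simp add: emeasure_distr)
  also have "\<dots> = (\<Prod>b\<in>Basis. (reindex (inv e) u - reindex (inv e) l) \<bullet> b)"
    using le' by (intro emeasure_lborel_box) (auto simp: Basis_vec_def inner_axis reindex_def)
  also have "(\<Prod>b\<in>Basis. (reindex (inv e) u - reindex (inv e) l) \<bullet> b) =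
    (\<Prod>j\<in>UNIV. (u - l) $ inv e j)"
    by (simp add: prod_Basis_vec reindex_def)
  also have "\<dots> = (\<Prod>i\<in>UNIV. (u - l) $ i)"
    by (rule prod.reindex_bij_betw[OF bij_imp_bij_inv[OF e]])
  also have "\<dots> = (\<Prod>b\<in>Basis. (u - l) \<bullet> b)"
    by (simp add: prod_Basis_vec)
  finally show "emeasure (distr lborel borel (reindex e)) (box l u) = ennreal (\<Prod>b\<in>Basis. (u - l) \<bullet> b)" .
qed simp

text \<open>\<open>E\<close> and \<open>E'\<close> identify the space with its copy over the
  well-ordered index type. They preserve Lebesgue measure and norms and commute with the inversion,
  so the formula is transported; finiteness of the integral provides the absolute
  integrability.\<close>

lemma nn_integral_inversion:
  fixes S :: "(real^'n) set" and f :: "real^'n \<Rightarrow> real"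
  assumes S [measurable]: "S \<in> sets borel" and "0 \<notin> S" "\<rho> \<noteq> 0"
    and f [measurable]: "f \<in> borel_measurable borel" and nonneg: "\<And>y. f y \<ge> 0"
    and int: "(\<integral>\<^sup>+ y\<in>inversion \<rho> ` S. f y \<partial>lborel) < \<infinity>"
  shows "(\<integral>\<^sup>+ y\<in>inversion \<rho> ` S. f y \<partial>lborel) =
    (\<integral>\<^sup>+ y\<in>S. ennreal ((\<bar>\<rho>\<bar> / norm y) ^ (2 * CARD('n)) * f (inversion \<rho> y)) \<partial>lborel)"
proof -
  obtain e :: "'n index \<Rightarrow> 'n" where e: "bij e"
    using finite_same_card_bij[of "UNIV :: 'n index set" "UNIV :: 'n set"] by auto
  define E where "E = reindex e"
  define E' where "E' = reindex (inv e)"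
  have EE: "E (E' z) = z" "E' (E y) = y" for y z
    by (auto simp: E_def E'_def reindex_reindex[OF e])
  have [measurable]: "E \<in> borel_measurable borel" "E' \<in> borel_measurable borel"
    by (auto simp: E_def E'_def)
  have inv: "inversion \<rho> (E' z) = E' (inversion \<rho> z)" for z
    using reindex_inversion[OF bij_imp_bij_inv[OF e]] by (simp add: E'_def)
  have nE: "norm (E' z) = norm z" for z
    using norm_reindex[OF bij_imp_bij_inv[OF e]] by (simp add: E'_def)
  define S' where "S' = E ` S"
  have S'_eq: "S' = E' -` S"
    unfolding S'_def using EE by (auto simp: image_iff) metis
  have [measurable]: "S' \<in> sets borel"
    unfolding S'_eq by (simp add: measurable_sets_borel[OF _ S])
  \<comment> \<open>Off the origin the inversion is its own inverse, so the image is also a preimage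
    and therefore measurable.\<close>
  have iS: "inversion \<rho> ` S = {y. y \<noteq> 0 \<and> inversion \<rho> y \<in> S}"
  proof (intro equalityI subsetI)
    fix y assume "y \<in> inversion \<rho> ` S"
    then obtain z where z: "z \<in> S" "y = inversion \<rho> z" by auto
    then have "z \<noteq> 0" using \<open>0 \<notin> S\<close> by auto
    then show "y \<in> {y. y \<noteq> 0 \<and> inversion \<rho> y \<in> S}"
      using z \<open>\<rho> \<noteq> 0\<close> inversion_inversion[of z \<rho>] by (auto simp: inversion_def)
  next
    fix y assume "y \<in> {y. y \<noteq> 0 \<and> inversion \<rho> y \<in> S}"
    then show "y \<in> inversion \<rho> ` S"
      using \<open>\<rho> \<noteq> 0\<close> inversion_inversion[of y \<rho>] by (intro image_eqI[of _ _ "inversion \<rho> y"]) auto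
  qed
  have [measurable]: "(inversion \<rho> :: real^'n \<Rightarrow> real^'n) \<in> borel_measurable borel"
    unfolding inversion_def[abs_def] by measurable
  have [measurable]: "inversion \<rho> ` S \<in> sets borel"
    unfolding iS by measurable
  have im: "inversion \<rho> ` S' = E' -` (inversion \<rho> ` S)"
  proof (intro equalityI subsetI)
    fix z assume "z \<in> inversion \<rho> ` S'"
    then show "z \<in> E' -` (inversion \<rho> ` S)"
      unfolding S'_eq using inv by (auto simp flip: inv)
  next
    fix z assume "z \<in> E' -` (inversion \<rho> ` S)"
    then obtain y where y: "y \<in> S" "E' z = inversion \<rho> y" by auto
    then have "E' z = E' (inversion \<rho> (E y))"
      by (simp flip: inv add: EE)
    then have "z = inversion \<rho> (E y)" by (metis EE(1))
    then show "z \<in> inversion \<rho> ` S'"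
      using y unfolding S'_def by auto
  qed
  have sub: "(\<integral>\<^sup>+ y\<in>A. g y \<partial>lborel) = (\<integral>\<^sup>+ z\<in>E' -` A. g (E' z) \<partial>lborel)"
    if [measurable]: "A \<in> sets borel" "g \<in> borel_measurable borel" for A and g :: "real^'n \<Rightarrow> ennreal"
  proof -
    have "(\<integral>\<^sup>+ y\<in>A. g y \<partial>lborel) = (\<integral>\<^sup>+ y\<in>A. g y \<partial>distr lborel borel E')"
      unfolding E'_def by (simp add: distr_lborel_reindex bij_imp_bij_inv[OF e])
    also have "\<dots> = (\<integral>\<^sup>+ z. g (E' z) * indicator A (E' z) \<partial>lborel)"
      by (rule nn_integral_distr) auto
    finally show ?thesis by (simp add: indicator_vimage o_def indicator_def cong: if_cong)
  qed
  have fin: "(\<integral>\<^sup>+ z\<in>inversion \<rho> ` S'. f (E' z) \<partial>lborel) < \<infinity>"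
    using int unfolding im by (subst sub[symmetric]) auto
  have [measurable]: "inversion \<rho> ` S' \<in> sets borel"
    unfolding im by (rule measurable_sets_borel[of E' borel]) auto
  have "(\<lambda>z. f (E' z)) absolutely_integrable_on inversion \<rho> ` S'"
  proof -
    have "integrable lborel (\<lambda>z. indicator (inversion \<rho> ` S') z *\<^sub>R f (E' z))"
    proof (rule integrableI_bounded)
      show "(\<integral>\<^sup>+ z. ennreal (norm (indicator (inversion \<rho> ` S') z *\<^sub>R f (E' z))) \<partial>lborel) < \<infinity>"
        using fin by (rule order.strict_trans1[rotated])
          (auto intro!: nn_integral_mono simp: indicator_def nonneg)
    qed measurable
    then show ?thesis
      unfolding set_integrable_def by (subst integrable_completion) auto
  qed
  moreover have "E' 0 = 0"
    using nE[of 0] by simp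
  then have zero: "0 \<notin> S'"
    using \<open>0 \<notin> S\<close> by (simp add: S'_eq)
  ultimately have "(\<integral>\<^sup>+ z\<in>inversion \<rho> ` S'. f (E' z) \<partial>lborel) =
      (\<integral>\<^sup>+ z\<in>S'. ennreal ((\<bar>\<rho>\<bar> / norm z) ^ (2 * CARD('n index)) * f (E' (inversion \<rho> z))) \<partial>lborel)"
    using \<open>\<rho> \<noteq> 0\<close> nonneg
    by (intro nn_integral_inversion_wellorder) (use zero in auto)
  then show ?thesis
    by (subst (1 2) sub) (auto simp: im[unfolded S'_eq] S'_eq nE simp flip: inv)
qed

section \<open>The radial barrier\<close>

lemma one_minus_powr_le:
  fixes v N :: real
  assumes "0 < v" "v \<le> 1" "1 \<le> N"
  shows "1 - v powr N \<le> N * (1 - v)"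
proof (cases "v = 1")
  case False
  then have "v < 1" using assms by simp
  have "\<exists>z. v < z \<and> z < 1 \<and> 1 powr N - v powr N = (1 - v) * (N * z powr (N - 1))"
  proof (rule MVT2[OF \<open>v < 1\<close>])
    fix x assume "v \<le> x" "x \<le> 1"
    then show "((\<lambda>x. x powr N) has_real_derivative N * x powr (N - 1)) (at x)"
      using assms by (intro has_real_derivative_powr) auto
  qed
  then obtain z where z: "v < z" "z < 1" "1 powr N - v powr N = (1 - v) * (N * z powr (N - 1))"
    by blast
  have "z powr (N - 1) \<le> 1"
    using z assms by (intro powr_le1) auto
  then have "(1 - v) * (N * z powr (N - 1)) \<le> (1 - v) * (N * 1)"
    using \<open>v < 1\<close> assms by (intro mult_left_mono) auto
  then show ?thesis
    using z by (simp add: mult.commute)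
qed simp

lemma powr_minus_diff_le:
  fixes X Y \<gamma> :: real
  assumes "0 < X" "X \<le> Y" "0 \<le> \<gamma>"
  shows "X powr (- \<gamma>) - Y powr (- \<gamma>) \<le> (Y - X) * \<gamma> * X powr (- \<gamma> - 1)"
proof (cases "X = Y")
  case False
  then have "X < Y" using assms by simp
  have "\<exists>z. X < z \<and> z < Y \<and>
      Y powr (- \<gamma>) - X powr (- \<gamma>) = (Y - X) * (- \<gamma> * z powr (- \<gamma> - 1))"
  proof (rule MVT2[OF \<open>X < Y\<close>])
    fix x assume "X \<le> x" "x \<le> Y"
    then show "((\<lambda>x. x powr (- \<gamma>)) has_real_derivative - \<gamma> * x powr (- \<gamma> - 1)) (at x)"
      using assms by (intro has_real_derivative_powr) auto
  qed
  then obtain z where z: "X < z" "z < Y"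
      "Y powr (- \<gamma>) - X powr (- \<gamma>) = (Y - X) * (- \<gamma> * z powr (- \<gamma> - 1))"
    by blast
  have "z powr (- \<gamma> - 1) \<le> X powr (- \<gamma> - 1)"
    using z assms by (intro powr_mono2') auto
  then have "(Y - X) * \<gamma> * z powr (- \<gamma> - 1) \<le> (Y - X) * \<gamma> * X powr (- \<gamma> - 1)"
    using \<open>X < Y\<close> assms by (intro mult_left_mono) auto
  then show ?thesis
    using z by (simp add: algebra_simps)
qed simp

text \<open>In the application \<open>\<alpha>\<close> is \<open>q * s\<close>, which is at most
  \<open>p / (p - 1)\<close> because \<open>p \<le> m\<close> and \<open>s < 1\<close>.
  \<open>R0\<close> is the depth up to which the barrier is saturated: the lower bound for the
  radius in the theorem, divided by \<open>\<beta>\<close>.\<close>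

locale radial_barrier =
  fixes p R R0 \<alpha> :: real
  assumes p: "1 < p" and R: "0 < R" and R0: "0 < R0" and \<alpha>: "0 < \<alpha>" "\<alpha> \<le> p / (p - 1)"
begin

definition \<beta> :: real where "\<beta> = p / (p - 1)"

text \<open>The primitive of \<open>- ((r / R) powr (\<beta> - 1))\<close> that vanishes at
  \<open>R\<close>. On \<open>[0, R]\<close> it lies between \<open>(R - r) / \<beta>\<close> and
  \<open>R - r\<close>, so it acts as a distance to the sphere whose derivative vanishes at the
  origin.\<close>

definition depth :: "real \<Rightarrow> real" where
  "depth r = R / \<beta> * (1 - (r / R) powr \<beta>)"

definition profile :: "real \<Rightarrow> real" where
  "profile r = 2 * (R0 / max R0 (depth r)) powr \<alpha>"

text \<open>Agrees with \<open>profile\<close> where the depth is at least \<open>R0\<close>;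
  \<open>slope\<close> is its derivative where \<open>r\<close> and \<open>depth r\<close> are
  positive.\<close>

definition untruncated :: "real \<Rightarrow> real" where
  "untruncated r = 2 * R0 powr \<alpha> * depth r powr (- \<alpha>)"

definition slope :: "real \<Rightarrow> real" where
  "slope r = 2 * \<alpha> * R0 powr \<alpha> * depth r powr (- \<alpha> - 1) * (r / R) powr (\<beta> - 1)"

section \<open>Monotonicity, convexity and derivatives of the radial functions\<close>

lemma \<beta>_gt_1: "1 < \<beta>"
  using p by (simp add: \<beta>_def field_simps)

text \<open>The reason for the choice of \<open>\<beta>\<close> as the conjugate exponent: the
  radial factor of \<open>slope\<close>, raised to the power \<open>p - 1\<close>, becomes exactly
  \<open>r / R\<close>.\<close>

lemma \<beta>_conj: "(\<beta> - 1) * (p - 1) = 1"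
  using p by (simp add: \<beta>_def field_simps)

lemma has_real_derivative_depth:
  assumes "0 < r"
  shows "(depth has_real_derivative - ((r / R) powr (\<beta> - 1))) (at r)"
proof -
  have "((\<lambda>r. R / \<beta> * (1 - (r / R) powr \<beta>)) has_real_derivative
      R / \<beta> * (0 - \<beta> * (r / R) powr (\<beta> - 1) * (1 / R))) (at r)"
    using assms R by (auto intro!: derivative_eq_intros)
  then show ?thesis
    using R \<beta>_gt_1 by (simp add: depth_def[abs_def])
qed

lemma continuous_on_depth: "continuous_on {0..} depth"
  unfolding depth_def[abs_def] using R \<beta>_gt_1
  by (intro continuous_intros continuous_on_powr') auto

lemma depth_antimono:
  assumes "0 \<le> a" "a \<le> b"
  shows "depth b \<le> depth a"
proof -
  have "(a / R) powr \<beta> \<le> (b / R) powr \<beta>"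
    using assms R \<beta>_gt_1 by (intro powr_mono2 divide_right_mono) auto
  then show ?thesis
    unfolding depth_def using R \<beta>_gt_1 by (intro mult_left_mono) auto
qed

text \<open>The derivative of \<open>depth\<close> has absolute value
  \<open>(r / R) powr (\<beta> - 1)\<close>, which is at most 1 up to \<open>R\<close>.
  \<open>MVT\<close> asks for differentiability only in the interior, so \<open>a = 0\<close> is
  covered by continuity.\<close>

lemma depth_diff_le:
  assumes "0 \<le> a" "a \<le> b" "b \<le> R"
  shows "depth a - depth b \<le> b - a"
proof (cases "a = b")
  case False
  then have "a < b" using assms by simp
  have "\<exists>l z. a < z \<and> z < b \<and> (depth has_real_derivative l) (at z) \<and> depth b - depth a = (b - a) * l"
  proof (intro MVT \<open>a < b\<close> continuous_on_subset[OF continuous_on_depth])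
    fix x assume "a < x"
    then show "depth differentiable (at x)"
      using assms has_real_derivative_depth[of x] by (auto simp: real_differentiable_def)
  qed (use assms in auto)
  then obtain l z where z: "a < z" "z < b" "(depth has_real_derivative l) (at z)"
    "depth b - depth a = (b - a) * l" by blast
  then have l: "l = - ((z / R) powr (\<beta> - 1))"
    using has_real_derivative_depth[of z] assms by (intro DERIV_unique[OF z(3)]) auto
  have "(z / R) powr (\<beta> - 1) \<le> 1"
    using z assms R \<beta>_gt_1 by (intro powr_le1) auto
  then have "(b - a) * (z / R) powr (\<beta> - 1) \<le> (b - a) * 1"
    using \<open>a < b\<close> by (intro mult_left_mono) auto
  then show ?thesis
    using z l by (simp add: algebra_simps)
qed simp

lemma depth_R: "depth R = 0"
  using R by (simp add: depth_def)

lemma depth_0: "depth 0 = R / \<beta>"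
  using R \<beta>_gt_1 by (simp add: depth_def)

lemma depth_le:
  assumes "0 \<le> r"
  shows "depth r < R"
proof -
  have "depth r \<le> R / \<beta>"
    using depth_antimono[of 0 r] assms depth_0 by simp
  also have "\<dots> < R"
    using R \<beta>_gt_1 by (simp add: field_simps)
  finally show ?thesis .
qed

lemma depth_ge:
  assumes "0 \<le> r" "r \<le> R"
  shows "(R - r) / \<beta> \<le> depth r"
proof -
  have "(r / R) powr \<beta> \<le> r / R"
  proof (cases "r = 0")
    case False
    then have "(r / R) powr \<beta> \<le> (r / R) powr 1"
      using assms R \<beta>_gt_1 by (intro powr_mono') auto
    then show ?thesis using assms R by simp
  qed (use \<beta>_gt_1 in simp)
  then have "R / \<beta> * (1 - r / R) \<le> depth r"
    unfolding depth_def using R \<beta>_gt_1 by (intro mult_left_mono) auto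
  moreover have "R / \<beta> * (1 - r / R) = (R - r) / \<beta>"
    using R \<beta>_gt_1 by (simp add: field_simps)
  ultimately show ?thesis by metis
qed

lemma depth_nonpos:
  assumes "R \<le> r"
  shows "depth r \<le> 0"
  using depth_antimono[of R r] depth_R R assms by simp

text \<open>As the radius grows, the depth shrinks under a negative exponent and the radial factor
  grows. This is the convexity of \<open>untruncated\<close>.\<close>

lemma slope_mono:
  assumes "0 \<le> a" "a \<le> b" "0 < depth b"
  shows "slope a \<le> slope b"
proof -
  have "depth a powr (- \<alpha> - 1) \<le> depth b powr (- \<alpha> - 1)"
    using assms \<alpha> depth_antimono[of a b] by (intro powr_mono2') auto
  moreover have "(a / R) powr (\<beta> - 1) \<le> (b / R) powr (\<beta> - 1)"
    using assms R \<beta>_gt_1 by (intro powr_mono2 divide_right_mono) auto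
  ultimately show ?thesis
    unfolding slope_def using \<alpha> by (intro mult_mono mult_left_mono) auto
qed

lemma slope_nonneg: "0 \<le> slope r"
  unfolding slope_def using \<alpha> by auto

text \<open>By the mean value theorem the difference quotient is a slope at an intermediate radius,
  and slopes are monotone.\<close>

lemma untruncated_diff:
  assumes "0 \<le> a" "a \<le> b" "0 < depth b"
  shows "slope a * (b - a) \<le> untruncated b - untruncated a" (is ?lower)
    and "untruncated b - untruncated a \<le> slope b * (b - a)" (is ?upper)
proof -
  have "?lower \<and> ?upper"
  proof (cases "a = b")
    case False
    then have "a < b" using assms by simp
    have pos: "0 < depth z" if "a \<le> z" "z \<le> b" for z
      using depth_antimono[of z b] assms that by auto
    have der: "(untruncated has_real_derivative slope z) (at z)" if "a < z" "z < b" for z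
    proof -
      have "((\<lambda>r. 2 * R0 powr \<alpha> * depth r powr (- \<alpha>)) has_real_derivative
          2 * R0 powr \<alpha> * (- \<alpha> * depth z powr (- \<alpha> - 1) * - ((z / R) powr (\<beta> - 1)))) (at z)"
        using that assms pos[of z]
        by (intro DERIV_cmult DERIV_fun_powr[OF has_real_derivative_depth, THEN DERIV_cong]) auto
      then show ?thesis
        by (simp add: untruncated_def[abs_def] slope_def mult_ac)
    qed
    have cont: "continuous_on {a..b} untruncated"
      unfolding untruncated_def[abs_def] using assms pos
      by (intro continuous_intros continuous_on_subset[OF continuous_on_depth]) force+
    have "\<exists>l z. a < z \<and> z < b \<and> (untruncated has_real_derivative l) (at z) \<and>
        untruncated b - untruncated a = (b - a) * l"
      using der by (intro MVT \<open>a < b\<close> cont) (auto simp: real_differentiable_def)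
    then obtain l z where z: "a < z" "z < b" "(untruncated has_real_derivative l) (at z)"
      "untruncated b - untruncated a = (b - a) * l" by blast
    then have l: "l = slope z"
      using der[of z] by (intro DERIV_unique[OF z(3)]) auto
    have "slope a \<le> slope z" "slope z \<le> slope b"
      using z assms pos by (intro slope_mono; simp)+
    then have "(b - a) * slope a \<le> (b - a) * slope z" "(b - a) * slope z \<le> (b - a) * slope b"
      using \<open>a < b\<close> by (auto intro!: mult_left_mono)
    then show ?thesis
      using z l by (simp add: mult.commute)
  qed simp
  then show ?lower ?upper by auto
qed

lemma slope_powr:
  assumes "0 \<le> r" "0 < depth r"
  shows "slope r powr (p - 1) =
    (2 * \<alpha> * R0 powr \<alpha>) powr (p - 1) * depth r powr (- ((\<alpha> + 1) * (p - 1))) * (r / R)"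
proof -
  have "(- \<alpha> - 1) * (p - 1) = - ((\<alpha> + 1) * (p - 1))"
    by (simp add: algebra_simps)
  then show ?thesis
    unfolding slope_def using assms R \<alpha> R0 \<beta>_conj by (simp add: powr_mult powr_powr)
qed

lemma profile_pos: "0 < profile r"
  unfolding profile_def using R0 by auto

lemma profile_le_2: "profile r \<le> 2"
proof -
  have "(R0 / max R0 (depth r)) powr \<alpha> \<le> 1"
    using R0 \<alpha> by (intro powr_le1) (auto simp: field_simps)
  then show ?thesis by (simp add: profile_def)
qed

lemma profile_eq_2:
  assumes "depth r \<le> R0"
  shows "profile r = 2"
  using assms R0 by (simp add: profile_def max_def)

lemma profile_eq_untruncated:
  assumes "R0 \<le> depth r"
  shows "profile r = untruncated r"
  using assms R0 by (simp add: profile_def untruncated_def max_absorb2 powr_divide powr_minus_divide)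

text \<open>Truncation at 2 only lowers the function. Hence outward increments of
  \<open>profile\<close> can be estimated through \<open>untruncated\<close> even if the outer point
  is saturated.\<close>

lemma profile_le_untruncated:
  assumes "0 < depth r"
  shows "profile r \<le> untruncated r"
proof (cases "R0 \<le> depth r")
  case False
  then have "R0 powr \<alpha> * depth r powr (- \<alpha>) = (R0 / depth r) powr \<alpha>"
    using assms R0 by (simp add: powr_divide powr_minus_divide)
  moreover have "1 \<le> (R0 / depth r) powr \<alpha>"
    using assms False \<alpha> by (intro ge_one_powr_ge_zero) (auto simp: field_simps)
  ultimately show ?thesis
    using False by (simp add: profile_eq_2 untruncated_def)
qed (simp add: profile_eq_untruncated)

lemma profile_mono:
  assumes "0 \<le> a" "a \<le> b"
  shows "profile a \<le> profile b"
proof -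
  have "R0 / max R0 (depth a) \<le> R0 / max R0 (depth b)"
    using depth_antimono[OF assms] R0 by (intro divide_left_mono) auto
  then show ?thesis
    unfolding profile_def using R0 \<alpha> by (intro mult_left_mono powr_mono2) auto
qed

lemma continuous_on_profile: "continuous_on {0..} profile"
proof -
  have "R0 / max R0 (depth r) \<noteq> 0" "max R0 (depth r) \<noteq> 0" for r using R0 by auto
  then show ?thesis
    unfolding profile_def[abs_def]
    by (intro continuous_intros continuous_on_depth) (auto simp del: divide_eq_0_iff)
qed

text \<open>Depends on \<open>p\<close> alone, although the slopes involve \<open>\<alpha>\<close>,
  \<open>R\<close> and \<open>R0\<close>; this uniformity passes to the constant of the
  theorem.\<close>

definition coeff :: real where
  "coeff = (2 * \<beta>) powr (p - 1) * 2 powr (2 * p)"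

lemma coeff_pos: "0 < coeff"
  using \<beta>_gt_1 by (simp add: coeff_def)

section \<open>Increments of the profile around an unsaturated radius\<close>

context
  fixes \<rho> D :: real
  assumes \<rho>: "0 \<le> \<rho>" and D: "D = depth \<rho>" "R0 < D"
begin

text \<open>This number is minus the exponent of the depth in \<open>slope_powr\<close>. The upper
  bound comes from \<open>\<alpha> \<le> \<beta>\<close> and makes the powers of 2 below independent
  of \<open>\<alpha>\<close>.\<close>

lemma \<gamma>_bounds: "0 < (\<alpha> + 1) * (p - 1)" "(\<alpha> + 1) * (p - 1) \<le> 2 * p - 1"
proof -
  show "0 < (\<alpha> + 1) * (p - 1)" using p \<alpha> by simp
  have "(\<alpha> + 1) * (p - 1) \<le> (\<beta> + 1) * (p - 1)"
    using p \<alpha> by (intro mult_right_mono) (auto simp: \<beta>_def)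
  also have "\<dots> = 2 * p - 1"
    using p by (simp add: \<beta>_def field_simps)
  finally show "(\<alpha> + 1) * (p - 1) \<le> 2 * p - 1" .
qed

text \<open>The powers of \<open>R0\<close> and \<open>D\<close> combine to a power of
  \<open>R0 / D < 1\<close> and a leftover \<open>D powr (1 - p)\<close>, while \<open>D / 2\<close>
  in place of \<open>D\<close> costs a power of 2. The extra factor 2 on the left serves the term
  where the exponent of \<open>D / 2\<close> is lowered by one.\<close>

lemma coeff_powr_le:
  "(2 * \<alpha> * R0 powr \<alpha>) powr (p - 1) * (D / 2) powr (- ((\<alpha> + 1) * (p - 1))) * 2
    \<le> coeff * D powr (1 - p)"
proof -
  let ?\<gamma> = "(\<alpha> + 1) * (p - 1)"
  have Dp: "0 < D" using D R0 by simp
  have eq: "(2 * \<alpha> * R0 powr \<alpha>) powr (p - 1) * (D / 2) powr (- ?\<gamma>) * 2 =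
    (2 * \<alpha> * (R0 / D) powr \<alpha>) powr (p - 1) * D powr (1 - p) * (2 powr (?\<gamma> + 1))"
  proof -
    have "D powr (- ?\<gamma>) = D powr (- \<alpha> * (p - 1)) * D powr (1 - p)"
    proof -
      have "- ?\<gamma> = - \<alpha> * (p - 1) + (1 - p)" by (simp add: algebra_simps)
      then show ?thesis by (simp only: powr_add)
    qed
    moreover have "(D / 2) powr (- ?\<gamma>) = D powr (- ?\<gamma>) * 2 powr ?\<gamma>"
      using Dp by (simp only: powr_divide powr_minus_divide) simp
    moreover have "(2 * \<alpha> * (R0 / D) powr \<alpha>) powr (p - 1) =
        (2 * \<alpha> * R0 powr \<alpha>) powr (p - 1) * D powr (- \<alpha> * (p - 1))"
    proof -
      have "(R0 / D) powr \<alpha> = R0 powr \<alpha> * D powr (- \<alpha>)"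
        using Dp R0 by (simp add: powr_divide powr_minus_divide)
      then show ?thesis
        using \<alpha> R0 Dp by (simp only: powr_mult powr_powr)
    qed
    ultimately show ?thesis
      by (simp add: powr_add)
  qed
  have "(R0 / D) powr \<alpha> \<le> 1"
    using D R0 \<alpha> by (intro powr_le1) auto
  then have "\<alpha> * (R0 / D) powr \<alpha> \<le> \<beta> * 1"
    using \<alpha> \<beta>_gt_1 by (intro mult_mono) (auto simp: \<beta>_def)
  then have "(2 * \<alpha> * (R0 / D) powr \<alpha>) powr (p - 1) \<le> (2 * \<beta>) powr (p - 1)"
    using \<alpha> p by (intro powr_mono2) auto
  moreover have "(2 :: real) powr (?\<gamma> + 1) \<le> 2 powr (2 * p)"
    using \<gamma>_bounds by (intro powr_mono) auto
  ultimately have "(2 * \<alpha> * (R0 / D) powr \<alpha>) powr (p - 1) * D powr (1 - p) * 2 powr (?\<gamma> + 1)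
      \<le> (2 * \<beta>) powr (p - 1) * D powr (1 - p) * 2 powr (2 * p)"
    by (intro mult_mono) auto
  then show ?thesis
    unfolding eq coeff_def by (simp add: mult_ac)
qed

text \<open>The depth decreases by at most the distance travelled, so an outward move by
  \<open>D / 2\<close> keeps half of the depth and stays below the radius \<open>R\<close>.\<close>

lemma depth_near:
  assumes "\<rho> \<le> r" "r \<le> \<rho> + D / 2"
  shows "D / 2 \<le> depth r" "r < R"
proof -
  have "\<rho> < R"
    using depth_nonpos[of \<rho>] D R0 by force
  moreover have "D \<le> R - \<rho>"
    using depth_diff_le[of \<rho> R] \<rho> depth_R D \<open>\<rho> < R\<close> by simp
  ultimately show "r < R"
    using assms by linarith
  then show "D / 2 \<le> depth r"
    using depth_diff_le[of \<rho> r] \<rho> assms D by simp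
qed

lemma D_pos: "0 < D" and D_less_R: "D < R"
  using D R0 depth_le[of \<rho>] \<rho> by auto

lemma profile_diff_le_slope:
  assumes "\<rho> \<le> r" "r \<le> \<rho> + D / 2"
  shows "profile r - profile \<rho> \<le> slope r * (r - \<rho>)"
proof -
  have "0 < depth r"
    using depth_near[OF assms] D_pos by linarith
  then have "profile r \<le> untruncated r" "untruncated r - untruncated \<rho> \<le> slope r * (r - \<rho>)"
    using untruncated_diff(2)[of \<rho> r] \<rho> assms by (auto intro: profile_le_untruncated)
  then show ?thesis
    using profile_eq_untruncated[of \<rho>] D by simp
qed

lemma D_powr: "D powr (1 - p) / R \<le> D powr (- p)" "D powr (1 - p) / D = D powr (- p)"
proof -
  show eq: "D powr (1 - p) / D = D powr (- p)"
    using D_pos powr_diff[of D "- p" "- 1"] powr_add[of D "- p" 1] by simp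
  show "D powr (1 - p) / R \<le> D powr (- p)"
    unfolding eq[symmetric] using D_pos D_less_R by (intro divide_left_mono) auto
qed

text \<open>The factor \<open>r\<close> comes from \<open>slope_powr\<close>, with \<open>R\<close>
  replaced by the smaller \<open>D\<close>. It is kept because it makes up for a missing power of
  the distance at points that are not paired.\<close>

lemma profile_diff_powr_le:
  assumes "\<rho> \<le> r" "r \<le> \<rho> + D / 2"
  shows "(profile r - profile \<rho>) powr (p - 1) \<le> coeff * D powr (- p) * r * (r - \<rho>) powr (p - 1)"
proof -
  have dr: "D / 2 \<le> depth r" by (rule depth_near[OF assms])
  have "(profile r - profile \<rho>) powr (p - 1) \<le> (slope r * (r - \<rho>)) powr (p - 1)"
    using profile_diff_le_slope[OF assms] profile_mono[OF \<rho>, of r] assms p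
    by (intro powr_mono2) auto
  also have "\<dots> = slope r powr (p - 1) * (r - \<rho>) powr (p - 1)"
    using slope_nonneg assms by (simp add: powr_mult)
  also have "\<dots> \<le> (coeff * D powr (- p) * r) * (r - \<rho>) powr (p - 1)"
  proof (rule mult_right_mono)
    have "slope r powr (p - 1) =
        (2 * \<alpha> * R0 powr \<alpha>) powr (p - 1) * depth r powr (- ((\<alpha> + 1) * (p - 1))) * (r / R)"
      using \<rho> assms dr D_pos by (intro slope_powr) auto
    also have "\<dots> \<le> (2 * \<alpha> * R0 powr \<alpha>) powr (p - 1) * (D / 2) powr (- ((\<alpha> + 1) * (p - 1))) * (r / R)"
      using \<rho> assms dr D_pos R \<gamma>_bounds
      by (intro mult_right_mono mult_left_mono powr_mono2') auto
    also have "\<dots> \<le> coeff * D powr (1 - p) * (r / R)"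
      using coeff_powr_le \<rho> assms R D_pos
      by (intro mult_right_mono) (auto intro: order_trans[rotated])
    also have "\<dots> = coeff * r * (D powr (1 - p) / R)"
      by simp
    also have "\<dots> \<le> coeff * r * D powr (- p)"
      using D_powr coeff_pos \<rho> assms by (intro mult_left_mono) auto
    finally show "slope r powr (p - 1) \<le> coeff * D powr (- p) * r"
      by (simp add: mult_ac)
  qed auto
  finally show ?thesis .
qed

text \<open>
  The exponent of the profile is chosen so that \<open>slope r powr (p - 1)\<close> is \<open>r\<close> times a smooth
  function of \<open>depth r\<close>, hence Lipschitz; this makes the first order terms of \<open>y\<close> and of its
  image under inversion cancel up to an integrable error.
\<close>

lemma profile_reflection:
  assumes "0 < \<rho>" "\<rho> < r" "r \<le> \<rho> + D / 2"
  shows "(profile r - profile \<rho>) powr (p - 1) \<le>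
    (\<rho> / r) ^ n * (profile \<rho> - profile (\<rho>\<^sup>2 / r)) powr (p - 1)
    + coeff * (real n + 5 * p + 1) * D powr (- p) * (r - \<rho>) powr p"
proof -
  \<comment> \<open>\<open>\<sigma>\<close> is the norm of the partner of a point of norm
    \<open>r\<close>. The radii \<open>r\<close>, \<open>\<rho>\<close>, \<open>\<sigma>\<close>
    form a geometric progression with ratio \<open>v\<close>, so the inward step
    \<open>\<rho> - \<sigma>\<close> is \<open>v\<close> times the outward step
    \<open>k\<close>.\<close>
  define \<sigma> where "\<sigma> = \<rho>\<^sup>2 / r"
  define k where "k = r - \<rho>"
  define \<gamma> where "\<gamma> = (\<alpha> + 1) * (p - 1)"
  define c where "c = (2 * \<alpha> * R0 powr \<alpha>) powr (p - 1)"
  define N where "N = real n + p + 1"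
  define v where "v = \<rho> / r"
  have k: "0 < k" "k \<le> D / 2" using assms by (auto simp: k_def)
  have r: "0 < r" using assms by simp
  have v: "0 < v" "v < 1" "v * r = \<rho>" using assms r by (auto simp: v_def)
  have \<sigma>v: "\<sigma> = v * \<rho>" by (simp add: \<sigma>_def v_def power2_eq_square)
  have \<sigma>k: "\<rho> - \<sigma> = v * k"
    using v r by (simp add: \<sigma>v k_def algebra_simps)
  have vk: "v * k \<le> k" using v k by simp
  have \<sigma>: "0 < \<sigma>" "\<sigma> \<le> \<rho>" using v assms by (auto simp: \<sigma>v)
  have dr: "D / 2 \<le> depth r" "r < R" using depth_near[of r] assms by auto
  have d\<sigma>: "D \<le> depth \<sigma>" using depth_antimono[of \<sigma> \<rho>] \<sigma> D by simp
  have X: "0 < depth r" using dr D_pos by linarith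
  have c: "0 \<le> c" by (simp add: c_def)
  have "(profile r - profile \<rho>) powr (p - 1) \<le> (slope r * k) powr (p - 1)"
    unfolding k_def
    using profile_diff_le_slope[of r] profile_mono[OF \<rho>, of r] assms p
    by (intro powr_mono2) auto
  also have "\<dots> = slope r powr (p - 1) * k powr (p - 1)"
    using slope_nonneg k by (simp add: powr_mult)
  finally have up: "(profile r - profile \<rho>) powr (p - 1) \<le> slope r powr (p - 1) * k powr (p - 1)" .
  \<comment> \<open>Convexity bounds the inward decrease from below by the slope at its inner end.
    Both depths are at least \<open>D\<close>, so the truncation does not interfere.\<close>
  have "slope \<sigma> * (v * k) \<le> profile \<rho> - profile \<sigma>"
    using untruncated_diff(1)[of \<sigma> \<rho>] \<sigma> \<sigma>k D D_pos d\<sigma>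
    by (simp add: profile_eq_untruncated)
  then have "(slope \<sigma> * (v * k)) powr (p - 1) \<le> (profile \<rho> - profile \<sigma>) powr (p - 1)"
    using p v k slope_nonneg by (intro powr_mono2) auto
  then have low: "slope \<sigma> powr (p - 1) * v powr (p - 1) * k powr (p - 1)
      \<le> (profile \<rho> - profile \<sigma>) powr (p - 1)"
    using slope_nonneg v k by (simp add: powr_mult mult_ac)
  have sr: "slope r powr (p - 1) = c * depth r powr (- \<gamma>) * (r / R)"
    unfolding c_def \<gamma>_def using r X by (intro slope_powr) auto
  have s\<sigma>: "slope \<sigma> powr (p - 1) = c * depth \<sigma> powr (- \<gamma>) * (r / R) * v\<^sup>2"
  proof -
    have "slope \<sigma> powr (p - 1) = c * depth \<sigma> powr (- \<gamma>) * (\<sigma> / R)"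
      unfolding c_def \<gamma>_def using \<sigma> d\<sigma> D_pos by (intro slope_powr) auto
    moreover have "\<sigma> = r * v\<^sup>2"
      by (simp add: \<sigma>v power2_eq_square flip: v(3))
    ultimately show ?thesis by simp
  qed
  have main: "slope r powr (p - 1) - v ^ n * (slope \<sigma> powr (p - 1) * v powr (p - 1))
      \<le> coeff * (real n + 5 * p + 1) * D powr (- p) * k"
  proof -
    \<comment> \<open>The powers of \<open>v\<close> collect: \<open>n\<close> from the weight, 2
      from the ratio of \<open>\<sigma>\<close> to \<open>r\<close>, and \<open>p - 1\<close> from
      the shorter inward step.\<close>
    have vN: "v ^ n * v\<^sup>2 * v powr (p - 1) = v powr N"
    proof -
      have "v ^ n * v\<^sup>2 * v powr (p - 1) = v powr real n * v powr 2 * v powr (p - 1)"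
        using v by (simp add: powr_realpow)
      also have "\<dots> = v powr (real n + 2 + (p - 1))"
        by (simp only: powr_add)
      also have "real n + 2 + (p - 1) = N"
        by (simp add: N_def)
      finally show ?thesis .
    qed
    have "slope r powr (p - 1) - v ^ n * (slope \<sigma> powr (p - 1) * v powr (p - 1)) =
        c * (r / R) * (depth r powr (- \<gamma>) - depth \<sigma> powr (- \<gamma>) * (v ^ n * v\<^sup>2 * v powr (p - 1)))"
      unfolding sr s\<sigma> by (simp add: algebra_simps)
    \<comment> \<open>The error splits into the variation of the depth between
      \<open>\<sigma>\<close> and \<open>r\<close> and the defect \<open>1 - v powr N\<close>; both
      are of first order in \<open>k\<close>.\<close>
    also have "\<dots> = c * (r / R) * (depth r powr (- \<gamma>) - depth \<sigma> powr (- \<gamma>))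
        + c * (r / R) * (depth \<sigma> powr (- \<gamma>) * (1 - v powr N))"
      unfolding vN by (simp add: algebra_simps)
    also have "c * (r / R) * (depth r powr (- \<gamma>) - depth \<sigma> powr (- \<gamma>))
        \<le> c * 1 * (2 * k * (2 * p) * (D / 2) powr (- \<gamma> - 1))"
    proof (intro mult_mono mult_left_mono)
      have "depth \<sigma> - depth r \<le> 2 * k"
        using depth_diff_le[of \<sigma> r] \<sigma> \<sigma>k vk assms dr k_def by linarith
      have "depth r powr (- \<gamma>) - depth \<sigma> powr (- \<gamma>)
          \<le> (depth \<sigma> - depth r) * \<gamma> * depth r powr (- \<gamma> - 1)"
        using X \<gamma>_bounds depth_antimono[of \<sigma> r] \<sigma> assms
        by (intro powr_minus_diff_le) (auto simp: \<gamma>_def)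
      also have "\<dots> \<le> (2 * k) * (2 * p) * (D / 2) powr (- \<gamma> - 1)"
        using \<open>depth \<sigma> - depth r \<le> 2 * k\<close> \<gamma>_bounds k D_pos dr p
        by (intro mult_mono powr_mono2') (auto simp: \<gamma>_def)
      finally show "depth r powr (- \<gamma>) - depth \<sigma> powr (- \<gamma>) \<le> 2 * k * (2 * p) * (D / 2) powr (- \<gamma> - 1)" .
      show "0 \<le> depth r powr (- \<gamma>) - depth \<sigma> powr (- \<gamma>)"
        using X \<gamma>_bounds depth_antimono[of \<sigma> r] \<sigma> assms by (auto intro!: powr_mono2' simp: \<gamma>_def)
    qed (use c R r dr k p in auto)
    also have "c * (r / R) * (depth \<sigma> powr (- \<gamma>) * (1 - v powr N))
        \<le> c * (r / R) * ((D / 2) powr (- \<gamma>) * (N * (1 - v)))"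
      using v p d\<sigma> D_pos c r R \<gamma>_bounds
      by (intro mult_left_mono mult_mono one_minus_powr_le powr_mono2')
         (auto simp: N_def \<gamma>_def intro!: powr_le1)
    \<comment> \<open>Since \<open>1 - v = k / r\<close>, the factor \<open>r\<close> of the slope
      cancels the denominator, and the estimate stays uniform as \<open>\<rho>\<close> tends to
      0.\<close>
    also have "\<dots> = c * (D / 2) powr (- \<gamma>) * N * (k / R)"
    proof -
      have "r * (1 - v) = k"
        using v(3) by (simp add: k_def algebra_simps)
      then show ?thesis
        by (metis (no_types, opaque_lifting) mult.commute mult.left_commute times_divide_eq_right)
    qed
    also have "c * 1 * (2 * k * (2 * p) * (D / 2) powr (- \<gamma> - 1)) + c * (D / 2) powr (- \<gamma>) * N * (k / R)
       \<le> c * 1 * (2 * k * (2 * p) * (D / 2) powr (- \<gamma> - 1)) + c * (D / 2) powr (- \<gamma>) * N * (k / D)"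
      using c p k D_pos D_less_R by (intro add_left_mono mult_left_mono divide_left_mono) (auto simp: N_def)
    also have "\<dots> = (c * (D / 2) powr (- \<gamma>) * 2) * ((k / D) * (4 * p + N / 2))"
      using D_pos by (simp add: powr_diff field_simps)
    also have "\<dots> \<le> coeff * D powr (1 - p) * ((k / D) * (real n + 5 * p + 1))"
    proof (rule mult_mono)
      show "c * (D / 2) powr (- \<gamma>) * 2 \<le> coeff * D powr (1 - p)"
        unfolding c_def \<gamma>_def by (rule coeff_powr_le)
      show "k / D * (4 * p + N / 2) \<le> k / D * (real n + 5 * p + 1)"
        using k D_pos p by (intro mult_left_mono) (auto simp: N_def)
    qed (use k D_pos p coeff_pos in \<open>auto simp: N_def\<close>)
    also have "\<dots> = coeff * (real n + 5 * p + 1) * (D powr (1 - p) / D) * k"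
      by simp
    finally show ?thesis
      unfolding D_powr by simp
  qed
  have "(profile r - profile \<rho>) powr (p - 1) \<le> slope r powr (p - 1) * k powr (p - 1)"
    by (rule up)
  also have "\<dots> \<le> (v ^ n * (slope \<sigma> powr (p - 1) * v powr (p - 1))
      + coeff * (real n + 5 * p + 1) * D powr (- p) * k) * k powr (p - 1)"
    using main by (intro mult_right_mono) auto
  also have "\<dots> = v ^ n * (slope \<sigma> powr (p - 1) * v powr (p - 1) * k powr (p - 1))
      + coeff * (real n + 5 * p + 1) * D powr (- p) * k powr p"
    using k by (simp add: algebra_simps powr_diff)
  also have "\<dots> \<le> v ^ n * (profile \<rho> - profile \<sigma>) powr (p - 1)
      + coeff * (real n + 5 * p + 1) * D powr (- p) * k powr p"
    using low v by (intro add_right_mono mult_left_mono) auto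
  finally show ?thesis
    by (simp add: v_def \<sigma>_def k_def)
qed

end

end

section \<open>Integrals of powers and almost monotone limits\<close>

lemma ex_power2_bracket:
  fixes y :: real
  assumes "1 \<le> y"
  shows "\<exists>k. 2 ^ k \<le> y \<and> y < 2 ^ Suc k"
proof -
  obtain j where "y < 2 ^ j"
    using real_arch_pow[of 2 y] by auto
  define m where "m = (LEAST j. y < (2 :: real) ^ j)"
  have m: "y < 2 ^ m"
    unfolding m_def using \<open>y < 2 ^ j\<close> by (rule LeastI)
  with assms obtain k where k: "m = Suc k"
    by (cases m) auto
  then have "\<not> y < 2 ^ k"
    using not_less_Least[of k "\<lambda>j. y < 2 ^ j"] by (simp add: m_def)
  with m k show ?thesis by force
qed

text \<open>The left side is the sum of a geometric series; the bound follows from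
  \<open>1 + x \<le> exp x\<close>. Its rate \<open>1 / \<gamma>\<close> is the source of the
  factors \<open>1 / s\<close> and \<open>1 / (1 - s)\<close>.\<close>

lemma one_div_one_minus_powr_le:
  fixes \<gamma> :: real
  assumes "0 < \<gamma>"
  shows "1 / (1 - 2 powr (- \<gamma>)) \<le> (\<gamma> + 2) / \<gamma>"
proof -
  define x where "x = \<gamma> * ln 2"
  have x: "0 < x" using assms by (simp add: x_def)
  have l: "1 / 2 \<le> ln (2 :: real)" using ln_2_less_1 ln2_ge_two_thirds by linarith
  have "2 powr (- \<gamma>) = inverse (exp x)"
    by (simp add: powr_def x_def exp_minus)
  also have "\<dots> \<le> inverse (1 + x)"
    using x exp_ge_add_one_self[of x] by (intro le_imp_inverse_le) auto
  finally have "x / (1 + x) \<le> 1 - 2 powr (- \<gamma>)"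
    using x by (simp add: field_simps)
  moreover have "0 < x / (1 + x)"
    using x by simp
  ultimately have "1 / (1 - 2 powr (- \<gamma>)) \<le> 1 / (x / (1 + x))"
    by (intro frac_le) auto
  also have "\<dots> = (\<gamma> + 1 / ln 2) / \<gamma>"
    using assms by (simp add: x_def field_simps)
  also have "\<dots> \<le> (\<gamma> + 2) / \<gamma>"
    using assms l by (intro divide_right_mono) (auto simp: field_simps)
  finally show ?thesis .
qed

text \<open>The function is dominated by a sum of constants on balls whose integrals are bounded by
  a geometric series. Whole balls in place of shells keep the volumes explicit.\<close>

lemma nn_integral_dyadic_le:
  fixes x :: "'a::euclidean_space" and f :: "'a \<Rightarrow> real"
  assumes cover: "\<And>y. y \<in> S \<Longrightarrow> f y \<noteq> 0 \<Longrightarrow> \<exists>k. norm (x - y) < r k \<and> f y \<le> a k"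
    and r: "\<And>k. 0 < r k" and a: "\<And>k. 0 \<le> a k"
    and le: "\<And>k. a k * r k ^ DIM('a) \<le> M * z ^ k" and M: "0 \<le> M" and z: "0 < z" "z < 1"
  shows "(\<integral>\<^sup>+ y\<in>S. f y \<partial>lborel) \<le> ennreal (unit_ball_vol DIM('a) * M / (1 - z))"
proof -
  have "(\<integral>\<^sup>+ y\<in>S. f y \<partial>lborel) \<le> (\<integral>\<^sup>+ y. (\<Sum>k. ennreal (a k) * indicator (ball x (r k)) y) \<partial>lborel)"
  proof (rule nn_integral_mono)
    fix y
    show "ennreal (f y) * indicator S y \<le> (\<Sum>k. ennreal (a k) * indicator (ball x (r k)) y)"
    proof (cases "y \<in> S \<and> f y \<noteq> 0")
      case True
      then obtain k where k: "norm (x - y) < r k" "f y \<le> a k"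
        using cover by blast
      have "ennreal (f y) * indicator S y \<le> (\<Sum>k\<in>{k}. ennreal (a k) * indicator (ball x (r k)) y)"
        using k True by (simp add: dist_norm ennreal_leI)
      also have "\<dots> \<le> (\<Sum>k. ennreal (a k) * indicator (ball x (r k)) y)"
        by (rule sum_le_suminf) auto
      finally show ?thesis .
    qed (auto simp: indicator_def)
  qed
  also have "\<dots> = (\<Sum>k. \<integral>\<^sup>+ y. ennreal (a k) * indicator (ball x (r k)) y \<partial>lborel)"
    by (intro nn_integral_suminf borel_measurable_times_ennreal borel_measurable_const
        borel_measurable_indicator) simp
  also have "\<dots> = (\<Sum>k. ennreal (unit_ball_vol DIM('a) * (a k * r k ^ DIM('a))))"
    using r a by (intro suminf_cong)
      (auto simp: nn_integral_cmult_indicator emeasure_ball less_imp_le mult_ac simp flip: ennreal_mult)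
  also have "\<dots> \<le> (\<Sum>k. ennreal (unit_ball_vol DIM('a) * (M * z ^ k)))"
    using le by (intro suminf_le ennreal_leI mult_left_mono) auto
  also have "\<dots> = ennreal (\<Sum>k. unit_ball_vol DIM('a) * M * z ^ k)"
    unfolding mult.assoc[symmetric] using z M
    by (intro suminf_ennreal2 summable_mult summable_geometric) auto
  also have "(\<Sum>k. unit_ball_vol DIM('a) * M * z ^ k) = unit_ball_vol DIM('a) * M / (1 - z)"
    using z by (subst suminf_mult) (auto simp: suminf_geometric)
  finally show ?thesis .
qed

lemma nn_integral_norm_powr_ball_le:
  fixes x :: "'a::euclidean_space"
  assumes "0 < \<delta>" "0 < \<gamma>"
  shows "(\<integral>\<^sup>+ y\<in>ball x \<delta>. norm (x - y) powr (\<gamma> - real DIM('a)) \<partial>lborel)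
    \<le> ennreal (2 ^ DIM('a) * unit_ball_vol DIM('a) * \<delta> powr \<gamma> * ((\<gamma> + 2) / \<gamma>))"
proof -
  define n where "n = DIM('a)"
  define z where "z = 2 powr (- \<gamma>)"
  define r where "r k = \<delta> / 2 ^ k" for k :: nat
  \<comment> \<open>Bounds the integrand between the radii \<open>r k / 2\<close> and
    \<open>r k\<close>. Numerator and denominator are estimated separately, so both signs of
    \<open>\<gamma> - n\<close> are covered.\<close>
  define a where "a k = r k powr \<gamma> / (r k / 2) ^ n" for k
  have z: "0 < z" "z < 1"
    using assms by (auto simp: z_def powr_less_one)
  have r: "0 < r k" for k using assms by (simp add: r_def)
  have "(\<integral>\<^sup>+ y\<in>ball x \<delta>. norm (x - y) powr (\<gamma> - real DIM('a)) \<partial>lborel)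
    \<le> ennreal (unit_ball_vol DIM('a) * (2 ^ n * \<delta> powr \<gamma>) / (1 - z))"
  proof (rule nn_integral_dyadic_le[where x = x and r = r and a = a])
    fix y assume y: "y \<in> ball x \<delta>" "norm (x - y) powr (\<gamma> - real DIM('a)) \<noteq> 0"
    define t where "t = norm (x - y)"
    \<comment> \<open>At \<open>y = x\<close> the integrand is \<open>0 powr _ = 0\<close>, so a
      nonzero value excludes this point.\<close>
    have t: "0 < t" "t < \<delta>" using y by (auto simp: t_def dist_norm)
    then obtain k where k: "2 ^ k \<le> \<delta> / t" "\<delta> / t < 2 ^ Suc k"
      using ex_power2_bracket[of "\<delta> / t"] by auto
    have tk: "t \<le> r k" "r k / 2 < t"
      using k t by (auto simp: r_def field_simps)
    have "t powr (\<gamma> - real n) = t powr \<gamma> / t ^ n"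
      using t by (simp add: powr_diff powr_realpow)
    also have "\<dots> \<le> a k"
      unfolding a_def using tk t r[of k] assms
      by (intro frac_le powr_mono2 power_mono) auto
    finally have le: "t powr (\<gamma> - real n) \<le> a k" .
    \<comment> \<open>The balls are open: a point at distance exactly \<open>r k\<close> goes to the
      next larger ball, which exists because \<open>t < \<delta> = r 0\<close>.\<close>
    show "\<exists>k. norm (x - y) < r k \<and> norm (x - y) powr (\<gamma> - real DIM('a)) \<le> a k"
    proof (cases "t = r k")
      case False
      then show ?thesis using tk le by (auto simp: t_def n_def intro!: exI[of _ k])
    next
      case True
      then obtain j where j: "k = Suc j"
        using t by (cases k) (auto simp: r_def)
      have rj: "r j = 2 * t" using True by (simp add: j r_def)
      have "t powr (\<gamma> - real n) = t powr \<gamma> / t ^ n"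
        using t by (simp add: powr_diff powr_realpow)
      also have "\<dots> \<le> a j"
        unfolding a_def rj using t assms by (intro frac_le powr_mono2) auto
      finally show ?thesis
        using rj t by (auto simp: t_def n_def intro!: exI[of _ j])
    qed
  next
    fix k
    have "a k * r k ^ DIM('a) = 2 ^ n * r k powr \<gamma>"
      using r[of k] by (simp add: a_def n_def power_divide)
    also have "r k powr \<gamma> = \<delta> powr \<gamma> * z ^ k"
      using assms by (simp add: r_def z_def powr_divide powr_powr mult.commute powr_minus_divide
        power_divide powr_realpow[symmetric])
    finally show "a k * r k ^ DIM('a) \<le> 2 ^ n * \<delta> powr \<gamma> * z ^ k" by simp
  qed (use z r assms in \<open>auto simp: a_def less_imp_le\<close>)
  also have "unit_ball_vol DIM('a) * (2 ^ n * \<delta> powr \<gamma>) / (1 - z) =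
      2 ^ n * unit_ball_vol DIM('a) * \<delta> powr \<gamma> * (1 / (1 - z))"
    by simp
  also have "ennreal \<dots> \<le> ennreal (2 ^ n * unit_ball_vol DIM('a) * \<delta> powr \<gamma> * ((\<gamma> + 2) / \<gamma>))"
    unfolding z_def using one_div_one_minus_powr_le[OF assms(2)]
    by (intro ennreal_leI mult_left_mono) auto
  finally show ?thesis by (simp add: n_def)
qed

lemma nn_integral_norm_powr_outside_ball_le:
  fixes x :: "'a::euclidean_space"
  assumes "0 < \<delta>" "0 < \<gamma>"
  shows "(\<integral>\<^sup>+ y\<in>- ball x \<delta>. norm (x - y) powr (- (real DIM('a) + \<gamma>)) \<partial>lborel)
    \<le> ennreal (2 ^ DIM('a) * unit_ball_vol DIM('a) * \<delta> powr (- \<gamma>) * ((\<gamma> + 2) / \<gamma>))"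
proof -
  define n where "n = DIM('a)"
  define z where "z = 2 powr (- \<gamma>)"
  define r where "r k = \<delta> * 2 ^ k" for k :: nat
  define a where "a k = r k powr (- (real n + \<gamma>))" for k
  have z: "0 < z" "z < 1"
    using assms by (auto simp: z_def powr_less_one)
  have r: "0 < r k" for k using assms by (simp add: r_def)
  have "(\<integral>\<^sup>+ y\<in>- ball x \<delta>. norm (x - y) powr (- (real DIM('a) + \<gamma>)) \<partial>lborel)
    \<le> ennreal (unit_ball_vol DIM('a) * (2 ^ n * \<delta> powr (- \<gamma>)) / (1 - z))"
  proof (rule nn_integral_dyadic_le[where x = x and r = "\<lambda>k. 2 * r k" and a = a])
    fix y assume y: "y \<in> - ball x \<delta>"
    define t where "t = norm (x - y)"
    have t: "\<delta> \<le> t" using y by (auto simp: t_def dist_norm)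
    then obtain k where k: "2 ^ k \<le> t / \<delta>" "t / \<delta> < 2 ^ Suc k"
      using ex_power2_bracket[of "t / \<delta>"] assms by auto
    have tk: "r k \<le> t" "t < 2 * r k"
      using k assms by (auto simp: r_def field_simps)
    then have "t powr (- (real n + \<gamma>)) \<le> a k"
      unfolding a_def using r[of k] assms by (intro powr_mono2') auto
    then show "\<exists>k. norm (x - y) < 2 * r k \<and> norm (x - y) powr (- (real DIM('a) + \<gamma>)) \<le> a k"
      using tk by (auto simp: t_def n_def)
  next
    fix k
    have "a k = r k powr (- \<gamma>) / r k ^ n"
      using r[of k] powr_diff[of "r k" "- \<gamma>" "real n"] minus_add_distrib[of "real n" \<gamma>]
      by (simp add: a_def powr_realpow add.commute)
    then have "a k * (2 * r k) ^ DIM('a) = 2 ^ n * r k powr (- \<gamma>)"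
      using r[of k] by (simp add: n_def power_mult_distrib)
    also have "r k powr (- \<gamma>) = \<delta> powr (- \<gamma>) * z ^ k"
      using assms by (simp add: r_def z_def powr_mult powr_powr mult.commute
        powr_realpow[symmetric])
    finally show "a k * (2 * r k) ^ DIM('a) \<le> 2 ^ n * \<delta> powr (- \<gamma>) * z ^ k" by simp
  qed (use z r assms in \<open>auto simp: a_def less_imp_le\<close>)
  also have "unit_ball_vol DIM('a) * (2 ^ n * \<delta> powr (- \<gamma>)) / (1 - z) =
      2 ^ n * unit_ball_vol DIM('a) * \<delta> powr (- \<gamma>) * (1 / (1 - z))"
    by simp
  also have "ennreal \<dots> \<le> ennreal (2 ^ n * unit_ball_vol DIM('a) * \<delta> powr (- \<gamma>) * ((\<gamma> + 2) / \<gamma>))"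
    unfolding z_def using one_div_one_minus_powr_le[OF assms(2)]
    by (intro ennreal_leI mult_left_mono) auto
  finally show ?thesis by (simp add: n_def)
qed

text \<open>A convex power lies below its chord over \<open>[0, 1]\<close>. This makes the volume of
  a shell linear in its relative thickness.\<close>

lemma one_plus_power_le:
  fixes \<eta> :: real
  assumes "0 \<le> \<eta>" "\<eta> \<le> 1"
  shows "(1 + \<eta>) ^ n \<le> 1 + (2 ^ n - 1) * \<eta>"
proof (induction n)
  case (Suc n)
  have c: "(1 :: real) \<le> 2 ^ n" by simp
  have "(1 + \<eta>) ^ Suc n \<le> (1 + \<eta>) * (1 + (2 ^ n - 1) * \<eta>)"
    using Suc assms by (simp add: mult_left_mono)
  also have "\<dots> = 1 + 2 ^ n * \<eta> + (2 ^ n - 1) * \<eta> * \<eta>"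
    by (simp add: algebra_simps)
  also have "\<dots> \<le> 1 + 2 ^ n * \<eta> + (2 ^ n - 1) * \<eta> * 1"
    using assms c by (intro add_left_mono mult_left_mono mult_nonneg_nonneg) auto
  finally show ?case by (simp add: algebra_simps)
qed simp

lemma emeasure_shell_le:
  fixes x :: "'a::euclidean_space"
  assumes "0 < \<epsilon>" "0 \<le> \<eta>" "\<eta> \<le> 1"
  shows "emeasure lborel (ball x (\<epsilon> * (1 + \<eta>)) - ball x \<epsilon>)
    \<le> ennreal (unit_ball_vol DIM('a) * \<epsilon> ^ DIM('a) * 2 ^ DIM('a) * \<eta>)"
proof -
  let ?n = "DIM('a)"
  have "ball x \<epsilon> \<subseteq> ball x (\<epsilon> * (1 + \<eta>))"
    using assms by (intro subset_ball) simp
  then have "emeasure lborel (ball x (\<epsilon> * (1 + \<eta>)) - ball x \<epsilon>) =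
      emeasure lborel (ball x (\<epsilon> * (1 + \<eta>))) - emeasure lborel (ball x \<epsilon>)"
    using assms by (intro emeasure_Diff) (auto simp: emeasure_ball)
  also have "\<dots> = ennreal (unit_ball_vol ?n * (\<epsilon> * (1 + \<eta>)) ^ ?n - unit_ball_vol ?n * \<epsilon> ^ ?n)"
    using assms by (simp add: emeasure_ball ennreal_minus)
  also have "\<dots> \<le> ennreal (unit_ball_vol ?n * \<epsilon> ^ ?n * 2 ^ ?n * \<eta>)"
  proof (rule ennreal_leI)
    have "unit_ball_vol ?n * (\<epsilon> * (1 + \<eta>)) ^ ?n - unit_ball_vol ?n * \<epsilon> ^ ?n =
        unit_ball_vol ?n * \<epsilon> ^ ?n * ((1 + \<eta>) ^ ?n - 1)"
      by (simp only: power_mult_distrib) (simp add: algebra_simps)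
    also have "\<dots> \<le> unit_ball_vol ?n * \<epsilon> ^ ?n * (2 ^ ?n * \<eta>)"
      using one_plus_power_le[OF assms(2,3), of ?n] assms
      by (intro mult_left_mono) (auto simp: algebra_simps)
    finally show "unit_ball_vol ?n * (\<epsilon> * (1 + \<eta>)) ^ ?n - unit_ball_vol ?n * \<epsilon> ^ ?n
        \<le> unit_ball_vol ?n * \<epsilon> ^ ?n * 2 ^ ?n * \<eta>"
      by (simp add: mult_ac)
  qed
  finally show ?thesis .
qed

text \<open>The limit is the infimum \<open>L\<close> of \<open>J + \<omega>\<close>: always
  \<open>L \<le> J \<epsilon> + \<omega> \<epsilon>\<close>, while near 0 the value of
  \<open>J\<close> is below each \<open>J \<epsilon>' + \<omega> \<epsilon>'\<close>, and
  \<open>\<omega>\<close> tends to 0. \<open>L\<close> may be minus infinity.\<close>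

lemma almost_monotone_tendsto:
  fixes J \<omega> :: "real \<Rightarrow> real"
  assumes "0 < \<delta>" and \<omega>: "(\<omega> \<longlongrightarrow> 0) (at_right 0)"
    and J: "\<And>\<epsilon> \<epsilon>'. 0 < \<epsilon> \<Longrightarrow> \<epsilon> < \<epsilon>' \<Longrightarrow> \<epsilon>' \<le> \<delta> \<Longrightarrow> J \<epsilon> \<le> J \<epsilon>' + \<omega> \<epsilon>'"
  shows "\<exists>L. ((\<lambda>\<epsilon>. ereal (J \<epsilon>)) \<longlongrightarrow> L) (at_right 0) \<and> L \<le> ereal (J \<delta> + \<omega> \<delta>)"
proof -
  define L where "L = (INF \<epsilon>\<in>{0<..\<delta>}. ereal (J \<epsilon> + \<omega> \<epsilon>))"
  have L: "L \<le> ereal (J \<epsilon> + \<omega> \<epsilon>)" if "0 < \<epsilon>" "\<epsilon> \<le> \<delta>" for \<epsilon>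
    unfolding L_def using that by (intro INF_lower) auto
  have "((\<lambda>\<epsilon>. ereal (J \<epsilon>)) \<longlongrightarrow> L) (at_right 0)"
  proof (rule order_tendstoI)
    fix a assume "a < L"
    then obtain b where b: "a < ereal b" "ereal b < L"
      using ereal_dense2 by blast
    show "\<forall>\<^sub>F \<epsilon> in at_right 0. a < ereal (J \<epsilon>)"
    proof (cases a)
      case (real a')
      then have "0 < b - a'" using b by simp
      then have "\<forall>\<^sub>F \<epsilon> in at_right 0. \<omega> \<epsilon> < b - a'"
        by (rule order_tendstoD(2)[OF \<omega>])
      moreover have "\<forall>\<^sub>F \<epsilon> in at_right 0. \<epsilon> \<in> {0<..<\<delta>}"
        using assms by (intro eventually_at_right_real) auto
      ultimately show ?thesis
      proof eventually_elim
        case (elim \<epsilon>)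
        then have "ereal b < ereal (J \<epsilon> + \<omega> \<epsilon>)"
          by (intro less_le_trans[OF b(2) L]) auto
        then show ?case using elim real by simp
      qed
    qed (use b in auto)
  next
    fix a assume "L < a"
    then obtain \<epsilon>' where e: "0 < \<epsilon>'" "\<epsilon>' \<le> \<delta>" "ereal (J \<epsilon>' + \<omega> \<epsilon>') < a"
      unfolding L_def by (auto simp: INF_less_iff)
    have "\<forall>\<^sub>F \<epsilon> in at_right 0. \<epsilon> \<in> {0<..<\<epsilon>'}"
      using e by (intro eventually_at_right_real) auto
    then show "\<forall>\<^sub>F \<epsilon> in at_right 0. ereal (J \<epsilon>) < a"
    proof eventually_elim
      case (elim \<epsilon>)
      then have "ereal (J \<epsilon>) \<le> ereal (J \<epsilon>' + \<omega> \<epsilon>')"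
        using J e by simp
      then show ?case using e(3) by (rule le_less_trans)
    qed
  qed
  then show ?thesis using L[of \<delta>] assms by auto
qed

section \<open>Estimates of the singular integral\<close>

context radial_barrier
begin

text \<open>\<open>rise\<close> and \<open>fall\<close> are the negative and the positive part of
  the integrand of the operator at \<open>x\<close>. As nonnegative functions they can be compared
  in \<open>ennreal\<close> before any subtraction.\<close>

definition rise :: "real \<Rightarrow> real^'n \<Rightarrow> real^'n \<Rightarrow> real" where
  "rise s x y = max 0 (profile (norm y) - profile (norm x)) powr (p - 1)
    * norm (x - y) powr (- (real CARD('n) + s * p))"

definition fall :: "real \<Rightarrow> real^'n \<Rightarrow> real^'n \<Rightarrow> real" where
  "fall s x y = max 0 (profile (norm x) - profile (norm y)) powr (p - 1)
    * norm (x - y) powr (- (real CARD('n) + s * p))"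

definition volume_const :: "nat \<Rightarrow> real" where
  "volume_const n = 3 * 2 ^ n * unit_ball_vol (real n)"

text \<open>Three contributions: \<open>real n + 5 * p + 1\<close> from paired points, 5 from annuli
  whose inner radius exceeds \<open>norm x / 4\<close>, and \<open>2 * 2 powr p\<close> from points
  without a partner.\<close>

definition local_const :: "nat \<Rightarrow> real" where
  "local_const n = coeff * volume_const n * (real n + 5 * p + 6 + 2 * 2 powr p)"

lemma volume_const_nonneg: "0 \<le> volume_const n"
  by (simp add: volume_const_def)

lemma local_const_nonneg: "0 \<le> local_const n"
  using coeff_pos volume_const_nonneg[of n] p by (simp add: local_const_def)

lemma rise_nonneg: "0 \<le> rise s x y" and fall_nonneg: "0 \<le> fall s x y"
  by (auto simp: rise_def fall_def)

lemma borel_measurable_profile_norm [measurable]: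
  "(\<lambda>y :: real^'n. profile (norm y)) \<in> borel_measurable borel"
  by (intro borel_measurable_continuous_onI continuous_on_compose2[OF continuous_on_profile])
     (auto intro: continuous_intros)

lemma borel_measurable_rise [measurable]: "rise s x \<in> borel_measurable borel"
  unfolding rise_def[abs_def] by measurable

lemma borel_measurable_fall [measurable]: "fall s x \<in> borel_measurable borel"
  unfolding fall_def[abs_def] by measurable

lemma rise_le: "rise s x y \<le> 2 powr (p - 1) * norm (x - y) powr (- (real CARD('n) + s * p))"
  and fall_le: "fall s x y \<le> 2 powr (p - 1) * norm (x - y) powr (- (real CARD('n) + s * p))"
  for x y :: "real^'n"
  unfolding rise_def fall_def
  using profile_pos[of "norm x"] profile_pos[of "norm y"] profile_le_2[of "norm x"] profile_le_2[of "norm y"] p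
  by (auto intro!: mult_right_mono powr_mono2)

lemma rise_eq_0: "norm y \<le> norm x \<Longrightarrow> rise s x y = 0"
  using profile_mono[of "norm y" "norm x"] by (simp add: rise_def)

text \<open>As \<open>p * t \<le> p\<close> and \<open>2 \<le> 2 * p\<close>, the numerator is at
  most \<open>3 * p\<close>. This is applied with \<open>t = s\<close> far from \<open>x\<close> and
  with \<open>t = 1 - s\<close> near \<open>x\<close>.\<close>

lemma add_2_divide_le:
  assumes "0 < t" "t < 1"
  shows "(p * t + 2) / (p * t) \<le> 3 / t"
proof -
  have "p * t \<le> p * 1"
    using assms p by (intro mult_left_mono) auto
  then have "(p * t + 2) / (p * t) \<le> 3 * p / (p * t)"
    using assms p by (intro divide_right_mono) (linarith, simp)
  then show ?thesis using p by simp
qed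

section \<open>Integrals of the kernel away from \<open>x\<close> and near \<open>x\<close>\<close>

lemma nn_integral_tail_le:
  fixes x :: "real^'n"
  assumes s: "0 < s" "s < 1" and "0 < \<delta>"
  shows "(\<integral>\<^sup>+ y\<in>- ball x \<delta>. norm (x - y) powr (- (real CARD('n) + s * p)) \<partial>lborel)
    \<le> ennreal (volume_const CARD('n) * \<delta> powr (- (s * p)) / s)"
proof -
  have "(s * p + 2) / (s * p) \<le> 3 / s"
    using add_2_divide_le[OF s] by (simp add: mult.commute)
  then have "2 ^ CARD('n) * unit_ball_vol CARD('n) * \<delta> powr (- (s * p)) * ((s * p + 2) / (s * p))
      \<le> 2 ^ CARD('n) * unit_ball_vol CARD('n) * \<delta> powr (- (s * p)) * (3 / s)"
    by (intro mult_left_mono) auto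
  then show ?thesis
    using nn_integral_norm_powr_outside_ball_le[of \<delta> "s * p" x] assms p
    by (auto simp: volume_const_def mult_ac intro: order_trans ennreal_leI)
qed

lemma nn_integral_near_le:
  fixes x :: "real^'n"
  assumes s: "0 < s" "s < 1" and "0 < \<delta>"
  shows "(\<integral>\<^sup>+ y\<in>ball x \<delta>. norm (x - y) powr p * norm (x - y) powr (- (real CARD('n) + s * p)) \<partial>lborel)
    \<le> ennreal (volume_const CARD('n) * \<delta> powr (p * (1 - s)) / (1 - s))"
proof -
  define \<gamma> where "\<gamma> = p * (1 - s)"
  have \<gamma>: "0 < \<gamma>" using s p by (simp add: \<gamma>_def)
  have "(\<gamma> + 2) / \<gamma> \<le> 3 / (1 - s)"
    unfolding \<gamma>_def using s by (intro add_2_divide_le) auto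
  then have "2 ^ CARD('n) * unit_ball_vol CARD('n) * \<delta> powr \<gamma> * ((\<gamma> + 2) / \<gamma>)
      \<le> 2 ^ CARD('n) * unit_ball_vol CARD('n) * \<delta> powr \<gamma> * (3 / (1 - s))"
    by (intro mult_left_mono) auto
  moreover have "norm (x - y) powr p * norm (x - y) powr (- (real CARD('n) + s * p)) =
      norm (x - y) powr (\<gamma> - real CARD('n))" for y
    by (simp add: \<gamma>_def algebra_simps flip: powr_add)
  ultimately show ?thesis
    using nn_integral_norm_powr_ball_le[of \<delta> \<gamma> x] assms \<gamma>
    by (auto simp: volume_const_def \<gamma>_def mult_ac intro: order_trans ennreal_leI)
qed

lemma finite_tail:
  fixes x :: "real^'n"
  assumes "0 < s" "s < 1" and "0 < \<delta>"
  shows "(\<integral>\<^sup>+ y\<in>- ball x \<delta>. rise s x y \<partial>lborel) \<le>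
      ennreal (2 powr (p - 1) * (volume_const CARD('n) * \<delta> powr (- (s * p)) / s))"
    and "(\<integral>\<^sup>+ y\<in>- ball x \<delta>. fall s x y \<partial>lborel) \<le>
      ennreal (2 powr (p - 1) * (volume_const CARD('n) * \<delta> powr (- (s * p)) / s))"
proof -
  have *: "(\<integral>\<^sup>+ y\<in>- ball x \<delta>. f y \<partial>lborel) \<le>
      ennreal (2 powr (p - 1) * (volume_const CARD('n) * \<delta> powr (- (s * p)) / s))"
    if "\<And>y. f y \<le> 2 powr (p - 1) * norm (x - y) powr (- (real CARD('n) + s * p))" for f :: "real^'n \<Rightarrow> real"
  proof -
    have "(\<integral>\<^sup>+ y\<in>- ball x \<delta>. f y \<partial>lborel) \<le>
        (\<integral>\<^sup>+ y. ennreal (2 powr (p - 1)) * (ennreal (norm (x - y) powr (- (real CARD('n) + s * p)))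
          * indicator (- ball x \<delta>) y) \<partial>lborel)"
      using that by (intro nn_integral_mono) (auto simp: indicator_def simp flip: ennreal_mult intro!: ennreal_leI)
    also have "\<dots> = ennreal (2 powr (p - 1)) *
        (\<integral>\<^sup>+ y\<in>- ball x \<delta>. norm (x - y) powr (- (real CARD('n) + s * p)) \<partial>lborel)"
      by (rule nn_integral_cmult) measurable
    also have "\<dots> \<le> ennreal (2 powr (p - 1)) * ennreal (volume_const CARD('n) * \<delta> powr (- (s * p)) / s)"
      by (intro mult_left_mono nn_integral_tail_le assms) auto
    finally show ?thesis
      using assms volume_const_nonneg by (simp flip: ennreal_mult)
  qed
  show "(\<integral>\<^sup>+ y\<in>- ball x \<delta>. rise s x y \<partial>lborel) \<le>
      ennreal (2 powr (p - 1) * (volume_const CARD('n) * \<delta> powr (- (s * p)) / s))"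
    by (rule *[OF rise_le])
  show "(\<integral>\<^sup>+ y\<in>- ball x \<delta>. fall s x y \<partial>lborel) \<le>
      ennreal (2 powr (p - 1) * (volume_const CARD('n) * \<delta> powr (- (s * p)) / s))"
    by (rule *[OF fall_le])
qed

lemma nn_integral_local_le:
  fixes x :: "real^'n"
  assumes s: "0 < s" "s < 1" and "0 < \<delta>" "0 \<le> c"
    and f: "\<And>y. y \<in> S \<Longrightarrow> norm (x - y) < \<delta> \<and>
      f y \<le> c * norm (x - y) powr p * norm (x - y) powr (- (real CARD('n) + s * p))"
  shows "(\<integral>\<^sup>+ y\<in>S. f y \<partial>lborel) \<le>
    ennreal (c * volume_const CARD('n) * \<delta> powr (p * (1 - s)) / (1 - s))"
proof -
  have [measurable]: "ball x \<delta> \<in> sets borel" by simp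
  have "(\<integral>\<^sup>+ y\<in>S. f y \<partial>lborel) \<le>
      (\<integral>\<^sup>+ y. ennreal c * (ennreal (norm (x - y) powr p * norm (x - y) powr (- (real CARD('n) + s * p)))
          * indicator (ball x \<delta>) y) \<partial>lborel)"
    using f \<open>0 \<le> c\<close>
    by (intro nn_integral_mono)
       (auto simp: indicator_def dist_norm mult.assoc simp flip: ennreal_mult intro!: ennreal_leI)
  also have "\<dots> = ennreal c *
      (\<integral>\<^sup>+ y\<in>ball x \<delta>. norm (x - y) powr p * norm (x - y) powr (- (real CARD('n) + s * p)) \<partial>lborel)"
    by (rule nn_integral_cmult) measurable
  also have "\<dots> \<le> ennreal c * ennreal (volume_const CARD('n) * \<delta> powr (p * (1 - s)) / (1 - s))"
    by (intro mult_left_mono nn_integral_near_le assms) auto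
  finally show ?thesis
    using assms volume_const_nonneg by (simp add: mult.assoc flip: ennreal_mult)
qed

section \<open>Pointwise bounds for \<open>rise\<close> close to \<open>x\<close>\<close>

lemma rise_le_slope:
  fixes x y :: "real^'n"
  assumes D: "D = depth (norm x)" "R0 < D" and t: "norm (x - y) \<le> D / 2"
  shows "rise s x y \<le> coeff * D powr (- p) * norm y * norm (x - y) powr (p - 1)
    * norm (x - y) powr (- (real CARD('n) + s * p))"
proof (cases "norm y \<le> norm x")
  case True
  then show ?thesis using coeff_pos by (simp add: rise_eq_0)
next
  case False
  have k: "norm y - norm x \<le> norm (x - y)"
    using norm_triangle_ineq2[of y x] by (simp add: norm_minus_commute)
  have "(profile (norm y) - profile (norm x)) powr (p - 1)
      \<le> coeff * D powr (- p) * norm y * (norm y - norm x) powr (p - 1)"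
    using False k t by (intro profile_diff_powr_le[OF _ D]) auto
  also have "\<dots> \<le> coeff * D powr (- p) * norm y * norm (x - y) powr (p - 1)"
    using False k coeff_pos p by (intro mult_left_mono powr_mono2) auto
  finally show ?thesis
    unfolding rise_def using profile_mono[of "norm x" "norm y"] False
    by (intro mult_right_mono) auto
qed

text \<open>The Jacobian contributes the exponent \<open>2 * n\<close> of
  \<open>norm x / norm y\<close>, the kernel at the partner contributes
  \<open>- (n + s * p)\<close>. The sum \<open>n - s * p\<close> is below the exponent
  \<open>n\<close> of \<open>profile_reflection\<close>, and the base is at most 1, so the weight
  there is dominated.\<close>

lemma rise_le_inversion:
  fixes x y :: "real^'n"
  assumes D: "D = depth (norm x)" "R0 < D" and t: "norm (x - y) \<le> D / 2"
    and xy: "0 < norm x" "norm x < norm y" and s: "0 < s"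
  shows "rise s x y \<le> (norm x / norm y) ^ (2 * CARD('n)) * fall s x (inversion (norm x) y)
    + coeff * (real CARD('n) + 5 * p + 1) * D powr (- p) * norm (x - y) powr p
      * norm (x - y) powr (- (real CARD('n) + s * p))"
proof -
  let ?n = "CARD('n)"
  let ?\<rho> = "norm x" and ?r = "norm y" and ?t = "norm (x - y)"
  let ?K = "?t powr (- (real ?n + s * p))"
  define b where "b = profile ?\<rho> - profile (?\<rho>\<^sup>2 / ?r)"
  have k: "?r - ?\<rho> \<le> ?t"
    using norm_triangle_ineq2[of y x] by (simp add: norm_minus_commute)
  have "0 < ?r" using xy by linarith
  then have v: "0 < ?\<rho> / ?r" "?\<rho> / ?r \<le> 1"
    using xy by (simp_all only: divide_pos_pos divide_le_eq_1_pos less_imp_le)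
  have "?\<rho>\<^sup>2 / ?r \<le> ?\<rho>"
    using mult_left_le[OF v(2), of ?\<rho>] by (simp add: power2_eq_square)
  then have b: "0 \<le> b"
    using profile_mono[of "?\<rho>\<^sup>2 / ?r" ?\<rho>] xy by (simp add: b_def)
  have "rise s x y = (profile ?r - profile ?\<rho>) powr (p - 1) * ?K"
    using profile_mono[of ?\<rho> ?r] xy by (simp add: rise_def)
  also have "(profile ?r - profile ?\<rho>) powr (p - 1) \<le> (?\<rho> / ?r) ^ ?n * b powr (p - 1)
      + coeff * (real ?n + 5 * p + 1) * D powr (- p) * (?r - ?\<rho>) powr p"
    unfolding b_def using xy k t by (intro profile_reflection[OF _ D]) auto
  also have "\<dots> \<le> (?\<rho> / ?r) ^ ?n * b powr (p - 1)
      + coeff * (real ?n + 5 * p + 1) * D powr (- p) * ?t powr p"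
    using xy k coeff_pos p by (intro add_left_mono mult_left_mono powr_mono2) auto
  finally have 1: "rise s x y \<le> (?\<rho> / ?r) ^ ?n * b powr (p - 1) * ?K
      + coeff * (real ?n + 5 * p + 1) * D powr (- p) * ?t powr p * ?K"
    by (simp add: distrib_right mult_right_mono)
  have ne: "x \<noteq> 0" "y \<noteq> 0" using xy by auto
  have "fall s x (inversion ?\<rho> y) = b powr (p - 1) * (?\<rho> / ?r * ?t) powr (- (real ?n + s * p))"
    using b norm_diff_inversion[of y x] ne by (simp add: fall_def norm_inversion b_def)
  also have "\<dots> = b powr (p - 1) * ((?\<rho> / ?r) powr (- (real ?n + s * p)) * ?K)"
    using v by (subst powr_mult) auto
  finally have f: "fall s x (inversion ?\<rho> y) = b powr (p - 1) * ((?\<rho> / ?r) powr (- (real ?n + s * p)) * ?K)" .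
  have "(?\<rho> / ?r) powr real ?n \<le> (?\<rho> / ?r) powr (real ?n - s * p)"
    using v s p by (intro powr_mono') auto
  also have "real ?n - s * p = real (2 * ?n) + (- (real ?n + s * p))"
    by simp
  also have "(?\<rho> / ?r) powr \<dots> = (?\<rho> / ?r) ^ (2 * ?n) * (?\<rho> / ?r) powr (- (real ?n + s * p))"
    using v by (simp only: powr_add powr_realpow)
  finally have "(?\<rho> / ?r) ^ ?n \<le> (?\<rho> / ?r) ^ (2 * ?n) * (?\<rho> / ?r) powr (- (real ?n + s * p))"
    using v by (simp only: powr_realpow)
  then have "(?\<rho> / ?r) ^ ?n * (b powr (p - 1) * ?K)
      \<le> (?\<rho> / ?r) ^ (2 * ?n) * (?\<rho> / ?r) powr (- (real ?n + s * p)) * (b powr (p - 1) * ?K)"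
    by (intro mult_right_mono) auto
  also have "\<dots> = (?\<rho> / ?r) ^ (2 * ?n) * fall s x (inversion ?\<rho> y)"
    unfolding f by (simp only: mult_ac)
  finally show ?thesis using 1 by (simp only: mult.assoc)
qed


section \<open>Comparison of \<open>rise\<close> with \<open>fall\<close> on annuli\<close>

lemma rise_annulus_le_far:
  fixes x :: "real^'n"
  assumes D: "D = depth (norm x)" "R0 < D" and s: "0 < s" "s < 1"
    and \<epsilon>: "0 < \<epsilon>" "\<epsilon> < \<epsilon>'" "\<epsilon>' \<le> D / 2" and far: "norm x < 4 * \<epsilon>"
  shows "(\<integral>\<^sup>+ y\<in>ball x \<epsilon>' - ball x \<epsilon>. rise s x y \<partial>lborel)
    \<le> ennreal (coeff * 5 * D powr (- p) * volume_const CARD('n) * \<epsilon>' powr (p * (1 - s)) / (1 - s))"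
proof (rule nn_integral_local_le[OF s])
  fix y assume "y \<in> ball x \<epsilon>' - ball x \<epsilon>"
  then have t: "\<epsilon> \<le> norm (x - y)" "norm (x - y) < \<epsilon>'" by (auto simp: dist_norm)
  have "norm y \<le> norm x + norm (x - y)"
    using norm_triangle_ineq4[of x "x - y"] by simp
  \<comment> \<open>Here \<open>norm x\<close> is at most comparable to the distance, so the factor
    \<open>norm y\<close> of \<open>rise_le_slope\<close> supplies the missing power of
    \<open>norm (x - y)\<close> without any cancellation.\<close>
  then have y: "norm y \<le> 5 * norm (x - y)" using t far by linarith
  have "rise s x y \<le> coeff * D powr (- p) * norm y * norm (x - y) powr (p - 1)
      * norm (x - y) powr (- (real CARD('n) + s * p))"
    using t \<epsilon> by (intro rise_le_slope D) auto
  also have "\<dots> \<le> coeff * D powr (- p) * (5 * norm (x - y)) * norm (x - y) powr (p - 1)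
      * norm (x - y) powr (- (real CARD('n) + s * p))"
    using y coeff_pos by (intro mult_right_mono mult_left_mono) auto
  also have "\<dots> = coeff * 5 * D powr (- p) * (norm (x - y) * norm (x - y) powr (p - 1))
      * norm (x - y) powr (- (real CARD('n) + s * p))"
    by (simp only: mult_ac)
  also have "norm (x - y) * norm (x - y) powr (p - 1) = norm (x - y) powr p"
    using t \<epsilon> by (auto simp: powr_mult_base)
  finally show "norm (x - y) < \<epsilon>' \<and> rise s x y \<le> coeff * 5 * D powr (- p) * norm (x - y) powr p
      * norm (x - y) powr (- (real CARD('n) + s * p))"
    using t by simp
qed (use \<epsilon> coeff_pos in auto)

text \<open>
  The complement of a ball around \<open>x\<close> is not invariant under the inversion. The points without a
  partner form the set \<open>X\<close> below; its volume gains a factor \<open>\<epsilon> / \<bar>x\<bar>\<close>, and the \<open>\<bar>x\<bar>\<close> in the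
  denominator is compensated by the factor \<open>norm y\<close> in the bound for \<open>rise\<close>.
\<close>

lemma rise_thin_shell_le:
  fixes x :: "real^'n"
  assumes D: "D = depth (norm x)" "R0 < D" and s: "0 < s" "s < 1"
    and \<epsilon>: "0 < \<epsilon>" "4 * \<epsilon> \<le> norm x"
    and X: "\<And>y. y \<in> X \<Longrightarrow> norm x < norm y \<and> \<epsilon> \<le> norm (x - y)
      \<and> norm (x - y) < \<epsilon> * norm y / norm x \<and> norm (x - y) \<le> D / 2"
  shows "(\<integral>\<^sup>+ y\<in>X. rise s x y \<partial>lborel)
    \<le> ennreal (coeff * (2 * 2 powr p) * D powr (- p) * volume_const CARD('n) * \<epsilon> powr (p * (1 - s)) / (1 - s))"
proof -
  let ?\<rho> = "norm x" and ?n = "CARD('n)"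
  \<comment> \<open>The relative thickness of a shell containing \<open>X\<close>: since
    \<open>norm y \<le> norm x + 4 * \<epsilon> / 3\<close>, as shown below, the distance bound
    \<open>\<epsilon> * norm y / norm x\<close> is at most
    \<open>\<epsilon> * (1 + \<eta>)\<close>.\<close>
  define \<eta> where "\<eta> = 4 * \<epsilon> / (3 * ?\<rho>)"
  define c where "c = coeff * D powr (- p) * (4 * ?\<rho> / 3) * (4 * \<epsilon> / 3) powr (p - 1)
    * \<epsilon> powr (- (real ?n + s * p))"
  have \<rho>: "0 < ?\<rho>" using \<epsilon> by linarith
  have \<eta>: "0 \<le> \<eta>" "\<eta> \<le> 1" using \<epsilon> \<rho> by (auto simp: \<eta>_def field_simps)
  have c: "0 \<le> c" using coeff_pos by (simp add: c_def)
  have y: "rise s x y \<le> c \<and> y \<in> ball x (\<epsilon> * (1 + \<eta>)) - ball x \<epsilon>" if "y \<in> X" for y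
  proof -
    let ?t = "norm (x - y)" and ?r = "norm y"
    note y = X[OF that]
    have "?r \<le> ?\<rho> + ?t"
      using norm_triangle_ineq4[of x "x - y"] by simp
    \<comment> \<open>The distance is less than a quarter of \<open>norm y\<close>; with the
      triangle inequality this yields the factors 4/3.\<close>
    have "\<epsilon> * ?r / ?\<rho> \<le> ?r / 4"
      using \<epsilon> \<rho> mult_right_mono[of "4 * \<epsilon>" ?\<rho> ?r] by (simp add: field_simps)
    then have r: "?r \<le> 4 * ?\<rho> / 3"
      using y \<open>?r \<le> ?\<rho> + ?t\<close> by linarith
    have "\<epsilon> * ?r / ?\<rho> \<le> \<epsilon> * (4 * ?\<rho> / 3) / ?\<rho>"
      using r \<epsilon> \<rho> by (intro divide_right_mono mult_left_mono) auto
    also have "\<dots> = 4 * \<epsilon> / 3" using \<rho> by simp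
    finally have t: "?t \<le> 4 * \<epsilon> / 3" using y by linarith
    have "\<epsilon> * ?r / ?\<rho> \<le> \<epsilon> * (?\<rho> + 4 * \<epsilon> / 3) / ?\<rho>"
      using \<open>?r \<le> ?\<rho> + ?t\<close> t \<epsilon> \<rho> by (intro divide_right_mono mult_left_mono) auto
    also have "\<dots> = \<epsilon> * (1 + \<eta>)"
      using \<rho> by (simp add: \<eta>_def field_simps)
    finally have "?t < \<epsilon> * (1 + \<eta>)" using y by linarith
    moreover have "rise s x y \<le> coeff * D powr (- p) * ?r * ?t powr (p - 1)
        * ?t powr (- (real ?n + s * p))"
      using y by (intro rise_le_slope D) auto
    then have "rise s x y \<le> c"
      unfolding c_def
    proof (rule order_trans)
      have "?t powr (- (real ?n + s * p)) \<le> \<epsilon> powr (- (real ?n + s * p))"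
        using y \<epsilon> mult_pos_pos[OF s(1), of p] p by (intro powr_mono2') auto
      moreover have "?t powr (p - 1) \<le> (4 * \<epsilon> / 3) powr (p - 1)"
        using t p by (intro powr_mono2) auto
      ultimately show "coeff * D powr (- p) * ?r * ?t powr (p - 1) * ?t powr (- (real ?n + s * p))
          \<le> coeff * D powr (- p) * (4 * ?\<rho> / 3) * (4 * \<epsilon> / 3) powr (p - 1) * \<epsilon> powr (- (real ?n + s * p))"
        using r coeff_pos by (intro mult_mono mult_left_mono) auto
    qed
    ultimately show ?thesis
      using y by (auto simp: dist_norm)
  qed
  have "(\<integral>\<^sup>+ y\<in>X. rise s x y \<partial>lborel)
      \<le> (\<integral>\<^sup>+ y. ennreal c * indicator (ball x (\<epsilon> * (1 + \<eta>)) - ball x \<epsilon>) y \<partial>lborel)"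
    using y by (intro nn_integral_mono) (auto simp: indicator_def intro!: ennreal_leI)
  also have "\<dots> = ennreal c * emeasure lborel (ball x (\<epsilon> * (1 + \<eta>)) - ball x \<epsilon>)"
    by (rule nn_integral_cmult_indicator) simp
  also have "\<dots> \<le> ennreal c * ennreal (unit_ball_vol ?n * \<epsilon> ^ ?n * 2 ^ ?n * \<eta>)"
    using emeasure_shell_le[OF \<epsilon>(1) \<eta>, of x] by (intro mult_left_mono) auto
  also have "\<dots> = ennreal (c * (unit_ball_vol ?n * \<epsilon> ^ ?n * 2 ^ ?n * \<eta>))"
    using c \<epsilon> \<eta> by (simp add: ennreal_mult)
  also have "c * (unit_ball_vol ?n * \<epsilon> ^ ?n * 2 ^ ?n * \<eta>) =
      coeff * D powr (- p) * volume_const ?n * (4 / 3 * (4 / 3) powr p / 3) * \<epsilon> powr (p * (1 - s))"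
  proof -
    have "\<epsilon> powr (p * (1 - s)) = \<epsilon> powr (p - 1 + (- (real ?n + s * p)) + real ?n + 1)"
      by (simp add: algebra_simps)
    also have "\<dots> = \<epsilon> powr (p - 1) * \<epsilon> powr (- (real ?n + s * p)) * \<epsilon> ^ ?n * \<epsilon>"
      using \<epsilon> by (simp only: powr_add powr_realpow) simp
    finally have 1: "\<epsilon> powr (p * (1 - s)) = \<epsilon> powr (p - 1) * \<epsilon> powr (- (real ?n + s * p)) * \<epsilon> ^ ?n * \<epsilon>" .
    have "(4 * \<epsilon> / 3) powr (p - 1) = (4 / 3) powr (p - 1) * \<epsilon> powr (p - 1)"
      using powr_mult[of "4 / 3" \<epsilon> "p - 1"] \<epsilon> by simp
    then have 2: "4 / 3 * (4 * \<epsilon> / 3) powr (p - 1) = (4 / 3) powr p * \<epsilon> powr (p - 1)"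
      using powr_mult_base[of "4 / 3" "p - 1"] by simp
    \<comment> \<open>The factor \<open>norm x\<close> of \<open>c\<close> cancels against the
      denominator of \<open>\<eta>\<close>.\<close>
    have "c * (unit_ball_vol ?n * \<epsilon> ^ ?n * 2 ^ ?n * \<eta>) = coeff * D powr (- p) * (unit_ball_vol ?n * 2 ^ ?n)
        * ((4 / 3 * (4 * \<epsilon> / 3) powr (p - 1)) * (\<epsilon> powr (- (real ?n + s * p)) * \<epsilon> ^ ?n * \<epsilon>)) * (?\<rho> * (4 / (3 * ?\<rho>)))"
      unfolding c_def \<eta>_def by (simp only: mult_ac times_divide_eq_right times_divide_eq_left)
    also have "?\<rho> * (4 / (3 * ?\<rho>)) = 4 / 3" using \<rho> by simp
    finally show ?thesis
      unfolding 2 1 volume_const_def by (simp add: mult_ac)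
  qed
  also have "ennreal \<dots> \<le> ennreal (coeff * D powr (- p) * volume_const ?n * (2 * 2 powr p)
      * (\<epsilon> powr (p * (1 - s)) / (1 - s)))"
  proof (intro ennreal_leI mult_mono mult_left_mono)
    have "(4 / 3 :: real) powr p \<le> 2 powr p" using p by (intro powr_mono2) auto
    moreover have "(0 :: real) \<le> 2 powr p" by simp
    ultimately show "4 / 3 * (4 / 3) powr p / 3 \<le> 2 * 2 powr p"
      by linarith
    show "\<epsilon> powr (p * (1 - s)) \<le> \<epsilon> powr (p * (1 - s)) / (1 - s)"
      using s by (simp add: field_simps mult_left_le)
  qed (use coeff_pos volume_const_nonneg s in auto)
  also have "coeff * D powr (- p) * volume_const ?n * (2 * 2 powr p) * (\<epsilon> powr (p * (1 - s)) / (1 - s))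
      = coeff * (2 * 2 powr p) * D powr (- p) * volume_const ?n * \<epsilon> powr (p * (1 - s)) / (1 - s)"
    by (simp add: mult_ac)
  finally show ?thesis .
qed



lemma tail_finite:
  fixes x :: "real^'n"
  assumes "0 < s" "s < 1" and "0 < \<delta>"
  shows "(\<integral>\<^sup>+ y\<in>- ball x \<delta>. rise s x y \<partial>lborel) < \<infinity>"
    and "(\<integral>\<^sup>+ y\<in>- ball x \<delta>. fall s x y \<partial>lborel) < \<infinity>"
  using le_less_trans[OF finite_tail(1)[OF assms, of x] ennreal_less_top]
    le_less_trans[OF finite_tail(2)[OF assms, of x] ennreal_less_top] by auto

lemma rise_annulus_le:
  fixes x :: "real^'n"
  assumes D: "D = depth (norm x)" "R0 < D" and s: "0 < s" "s < 1"
    and \<epsilon>: "0 < \<epsilon>" "\<epsilon> < \<epsilon>'" "\<epsilon>' \<le> D / 2"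
  shows "(\<integral>\<^sup>+ y\<in>ball x \<epsilon>' - ball x \<epsilon>. rise s x y \<partial>lborel)
    \<le> (\<integral>\<^sup>+ y\<in>ball x \<epsilon>' - ball x \<epsilon>. fall s x y \<partial>lborel)
      + ennreal (local_const CARD('n) * D powr (- p) * (\<epsilon>' powr (p * (1 - s)) / (1 - s)))"
proof -
  let ?n = "CARD('n)" and ?\<rho> = "norm x"
  let ?A = "ball x \<epsilon>' - ball x \<epsilon>"
  define E where "E = D powr (- p) * (\<epsilon>' powr (p * (1 - s)) / (1 - s))"
  have E: "0 \<le> E" using s by (simp add: E_def)
  define v where "v = coeff * volume_const ?n"
  have v: "0 \<le> v" using coeff_pos volume_const_nonneg by (simp add: v_def)
  have Cv: "local_const ?n * D powr (- p) * (\<epsilon>' powr (p * (1 - s)) / (1 - s)) =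
      v * (real ?n + 5 * p + 6 + 2 * 2 powr p) * E"
    by (simp add: local_const_def v_def E_def)
  show ?thesis
  proof (cases "?\<rho> < 4 * \<epsilon>")
    case True
    have "(\<integral>\<^sup>+ y\<in>?A. rise s x y \<partial>lborel) \<le> ennreal (v * 5 * E)"
      using rise_annulus_le_far[OF D s \<epsilon> True] by (simp add: v_def E_def mult_ac)
    also have "\<dots> \<le> ennreal (v * (real ?n + 5 * p + 6 + 2 * 2 powr p) * E)"
      using v E p by (intro ennreal_leI mult_right_mono mult_left_mono) auto
    also have "\<dots> \<le> (\<integral>\<^sup>+ y\<in>?A. fall s x y \<partial>lborel) + \<dots>"
      by simp
    finally show ?thesis unfolding Cv .
  next
    case False
    then have \<rho>: "4 * \<epsilon> \<le> ?\<rho>" "0 < ?\<rho>" using \<epsilon> by auto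
    define \<iota> where "\<iota> = (inversion ?\<rho> :: real^'n \<Rightarrow> real^'n)"
    \<comment> \<open>The partner of \<open>y\<close> has distance
      \<open>norm x / norm y * norm (x - y)\<close> from \<open>x\<close>. It stays outside
      \<open>ball x \<epsilon>\<close> for \<open>y\<close> in \<open>S\<close> and falls into it
      for \<open>y\<close> in \<open>X\<close>. Points with \<open>norm y \<le> norm x\<close> have
      \<open>rise\<close> zero.\<close>
    define S where "S = {y. ?\<rho> < norm y \<and> \<epsilon> * norm y / ?\<rho> \<le> norm (x - y) \<and> norm (x - y) < \<epsilon>'}"
    define X where "X = {y. ?\<rho> < norm y \<and> \<epsilon> \<le> norm (x - y) \<and> norm (x - y) < \<epsilon> * norm y / ?\<rho> \<and> norm (x - y) < \<epsilon>'}"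
    have "{y \<in> space borel. ?\<rho> < norm y \<and> \<epsilon> * norm y / ?\<rho> \<le> norm (x - y) \<and> norm (x - y) < \<epsilon>'}
        \<in> sets borel"
      by measurable
    then have [measurable]: "S \<in> sets borel"
      by (simp add: S_def)
    have "{y \<in> space borel. ?\<rho> < norm y \<and> \<epsilon> \<le> norm (x - y) \<and> norm (x - y) < \<epsilon> * norm y / ?\<rho>
        \<and> norm (x - y) < \<epsilon>'} \<in> sets borel"
      by measurable
    then have [measurable]: "X \<in> sets borel"
      by (simp add: X_def)
    have \<iota>S: "\<iota> ` S \<subseteq> ?A"
    proof
      fix z assume "z \<in> \<iota> ` S"
      then obtain y where y: "z = \<iota> y" "?\<rho> < norm y" "\<epsilon> * norm y / ?\<rho> \<le> norm (x - y)" "norm (x - y) < \<epsilon>'"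
        by (auto simp: S_def)
      have "0 < norm y" using y \<rho> by linarith
      then have n: "norm (x - z) = ?\<rho> / norm y * norm (x - y)"
        using \<rho> y norm_diff_inversion[of y x] by (auto simp: \<iota>_def)
      have "\<epsilon> \<le> norm (x - z)"
        using y(3) \<rho> \<open>0 < norm y\<close> by (simp add: n field_simps)
      moreover have "norm (x - z) \<le> 1 * norm (x - y)"
        unfolding n using y(2) \<open>0 < norm y\<close> by (intro mult_right_mono) (auto simp: divide_le_eq_1_pos)
      ultimately show "z \<in> ?A" using y(4) by (auto simp: dist_norm)
    qed
    have fin: "(\<integral>\<^sup>+ y\<in>\<iota> ` S. fall s x y \<partial>lborel) < \<infinity>"
    proof -
      have "(\<integral>\<^sup>+ y\<in>\<iota> ` S. fall s x y \<partial>lborel) \<le> (\<integral>\<^sup>+ y\<in>- ball x \<epsilon>. fall s x y \<partial>lborel)"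
        using \<iota>S by (intro nn_integral_mono) (auto simp: indicator_def)
      then show ?thesis
        using tail_finite(2)[OF s \<epsilon>(1), of x] by simp
    qed
    have "(\<integral>\<^sup>+ y\<in>S. rise s x y \<partial>lborel) \<le>
        (\<integral>\<^sup>+ y. (ennreal ((\<bar>?\<rho>\<bar> / norm y) ^ (2 * ?n) * fall s x (\<iota> y)) * indicator S y
          + ennreal (coeff * (real ?n + 5 * p + 1) * D powr (- p) * norm (x - y) powr p
            * norm (x - y) powr (- (real ?n + s * p))) * indicator S y) \<partial>lborel)"
    proof (rule nn_integral_mono)
      fix y
      define a where "a = (\<bar>?\<rho>\<bar> / norm y) ^ (2 * ?n) * fall s x (\<iota> y)"
      define b where "b = coeff * (real ?n + 5 * p + 1) * D powr (- p) * norm (x - y) powr p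
            * norm (x - y) powr (- (real ?n + s * p))"
      have "0 \<le> a" "0 \<le> b"
        using fall_nonneg[of s x "\<iota> y"] coeff_pos p by (auto simp: a_def b_def)
      moreover have "rise s x y \<le> a + b" if "y \<in> S"
        using rise_le_inversion[OF D _ \<rho>(2) _ s(1), of y] that \<epsilon> by (simp add: a_def b_def S_def \<iota>_def)
      ultimately show "ennreal (rise s x y) * indicator S y \<le> ennreal a * indicator S y + ennreal b * indicator S y"
        by (cases "y \<in> S") (auto simp flip: ennreal_plus intro: ennreal_leI)
    qed
    also have "\<dots> = (\<integral>\<^sup>+ y\<in>S. ennreal ((\<bar>?\<rho>\<bar> / norm y) ^ (2 * ?n) * fall s x (\<iota> y)) \<partial>lborel)
        + (\<integral>\<^sup>+ y\<in>S. ennreal (coeff * (real ?n + 5 * p + 1) * D powr (- p) * norm (x - y) powr p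
            * norm (x - y) powr (- (real ?n + s * p))) \<partial>lborel)"
      unfolding \<iota>_def inversion_def[abs_def] by (rule nn_integral_add) measurable
    also have "\<dots> \<le> (\<integral>\<^sup>+ y\<in>?A. fall s x y \<partial>lborel) + ennreal (v * (real ?n + 5 * p + 1) * E)"
    \<comment> \<open>The first summand is, by the change of variables, the integral of
      \<open>fall\<close> over the partners, which lie in the same annulus. The second is the error
      left by the cancellation.\<close>
    proof (rule add_mono)
      have "(\<integral>\<^sup>+ y\<in>S. ennreal ((\<bar>?\<rho>\<bar> / norm y) ^ (2 * ?n) * fall s x (\<iota> y)) \<partial>lborel)
          = (\<integral>\<^sup>+ y\<in>\<iota> ` S. fall s x y \<partial>lborel)"
        using fin \<rho> unfolding \<iota>_def
        by (intro nn_integral_inversion[symmetric] fall_nonneg) (auto simp: S_def)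
      also have "\<dots> \<le> (\<integral>\<^sup>+ y\<in>?A. fall s x y \<partial>lborel)"
        using \<iota>S by (intro nn_integral_mono) (auto simp: indicator_def)
      finally show "(\<integral>\<^sup>+ y\<in>S. ennreal ((\<bar>?\<rho>\<bar> / norm y) ^ (2 * ?n) * fall s x (\<iota> y)) \<partial>lborel)
          \<le> (\<integral>\<^sup>+ y\<in>?A. fall s x y \<partial>lborel)" .
    next
      have "(\<integral>\<^sup>+ y\<in>S. ennreal (coeff * (real ?n + 5 * p + 1) * D powr (- p) * norm (x - y) powr p
              * norm (x - y) powr (- (real ?n + s * p))) \<partial>lborel)
          \<le> ennreal (coeff * (real ?n + 5 * p + 1) * D powr (- p) * volume_const ?n
              * \<epsilon>' powr (p * (1 - s)) / (1 - s))"
        using \<epsilon> coeff_pos p by (intro nn_integral_local_le s) (auto simp: S_def)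
      also have "\<dots> = ennreal (v * (real ?n + 5 * p + 1) * E)"
        by (simp add: v_def E_def mult_ac)
      finally show "(\<integral>\<^sup>+ y\<in>S. ennreal (coeff * (real ?n + 5 * p + 1) * D powr (- p) * norm (x - y) powr p
              * norm (x - y) powr (- (real ?n + s * p))) \<partial>lborel) \<le> ennreal (v * (real ?n + 5 * p + 1) * E)" .
    qed
    finally have onS: "(\<integral>\<^sup>+ y\<in>S. rise s x y \<partial>lborel) \<le> (\<integral>\<^sup>+ y\<in>?A. fall s x y \<partial>lborel)
        + ennreal (v * (real ?n + 5 * p + 1) * E)" .
    have "(\<integral>\<^sup>+ y\<in>X. rise s x y \<partial>lborel)
      \<le> ennreal (coeff * (2 * 2 powr p) * D powr (- p) * volume_const ?n * \<epsilon> powr (p * (1 - s)) / (1 - s))"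
      using \<epsilon> by (intro rise_thin_shell_le[OF D s \<epsilon>(1) \<rho>(1)]) (auto simp: X_def)
    also have "\<dots> \<le> ennreal (v * (2 * 2 powr p) * E)"
    proof (rule ennreal_leI)
      have "\<epsilon> powr (p * (1 - s)) / (1 - s) \<le> \<epsilon>' powr (p * (1 - s)) / (1 - s)"
        using \<epsilon> p s by (intro divide_right_mono powr_mono2) auto
      then have "v * (2 * 2 powr p) * (D powr (- p) * (\<epsilon> powr (p * (1 - s)) / (1 - s))) \<le> v * (2 * 2 powr p) * E"
        unfolding E_def using v by (intro mult_left_mono) auto
      then show "coeff * (2 * 2 powr p) * D powr (- p) * volume_const ?n * \<epsilon> powr (p * (1 - s)) / (1 - s)
          \<le> v * (2 * 2 powr p) * E"
        by (simp add: v_def mult_ac)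
    qed
    finally have onX: "(\<integral>\<^sup>+ y\<in>X. rise s x y \<partial>lborel) \<le> ennreal (v * (2 * 2 powr p) * E)" .
    have "(\<integral>\<^sup>+ y\<in>?A. rise s x y \<partial>lborel) \<le>
        (\<integral>\<^sup>+ y. (ennreal (rise s x y) * indicator S y + ennreal (rise s x y) * indicator X y) \<partial>lborel)"
    proof (rule nn_integral_mono)
      fix y
      show "ennreal (rise s x y) * indicator ?A y \<le>
          ennreal (rise s x y) * indicator S y + ennreal (rise s x y) * indicator X y"
        using rise_eq_0[of y x s]
        by (cases "norm y \<le> ?\<rho>") (auto simp: indicator_def S_def X_def dist_norm)
    qed
    also have "\<dots> = (\<integral>\<^sup>+ y\<in>S. rise s x y \<partial>lborel) + (\<integral>\<^sup>+ y\<in>X. rise s x y \<partial>lborel)"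
      by (rule nn_integral_add) measurable
    also have "\<dots> \<le> ((\<integral>\<^sup>+ y\<in>?A. fall s x y \<partial>lborel) + ennreal (v * (real ?n + 5 * p + 1) * E))
        + ennreal (v * (2 * 2 powr p) * E)"
      by (intro add_mono onS onX)
    also have "\<dots> = (\<integral>\<^sup>+ y\<in>?A. fall s x y \<partial>lborel)
        + ennreal (v * (real ?n + 5 * p + 1) * E + v * (2 * 2 powr p) * E)"
      using v E p by (simp add: add.assoc)
    also have "\<dots> \<le> (\<integral>\<^sup>+ y\<in>?A. fall s x y \<partial>lborel)
        + ennreal (v * (real ?n + 5 * p + 6 + 2 * 2 powr p) * E)"
    proof (intro add_left_mono ennreal_leI)
      have "v * (real ?n + 5 * p + 1) * E + v * (2 * 2 powr p) * E + 5 * (v * E) =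
          v * (real ?n + 5 * p + 6 + 2 * 2 powr p) * E"
        by (simp add: algebra_simps)
      moreover have "0 \<le> v * E" using v E by simp
      ultimately show "v * (real ?n + 5 * p + 1) * E + v * (2 * 2 powr p) * E
          \<le> v * (real ?n + 5 * p + 6 + 2 * 2 powr p) * E" by linarith
    qed
    finally show ?thesis unfolding Cv .
  qed
qed

end

section \<open>The principal value\<close>

lemma nn_integral_lebesgue_on:
  assumes "S \<in> sets borel"
  shows "(\<integral>\<^sup>+ y. f y \<partial>lebesgue_on S) = (\<integral>\<^sup>+ y\<in>S. f y \<partial>lborel)"
  using assms by (simp add: nn_integral_restrict_space nn_integral_completion)

context radial_barrier
begin

section \<open>Truncated integrals and their limit\<close>

definition total_const :: "nat \<Rightarrow> real" where
  "total_const n = 2 powr (2 * p) * volume_const n + local_const n"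

text \<open>The integrand has the sign of \<open>d\<close> and the size
  \<open>\<bar>d\<bar> powr (p - 1)\<close> times the kernel, and \<open>ennreal\<close> cuts off
  negative values. For \<open>d = 0\<close> all terms are 0.\<close>

lemma ennreal_frac_p_integrand:
  fixes x y :: "real^'n" and s :: real
  defines "f \<equiv> frac_p_integrand s p (\<lambda>y. profile (norm y) - 1) x y"
  shows "ennreal f = ennreal (fall s x y)" "ennreal (- f) = ennreal (rise s x y)"
proof -
  define d where "d = profile (norm x) - profile (norm y)"
  have f: "f = d * \<bar>d\<bar> powr (p - 2) * norm (x - y) powr (- (real CARD('n) + s * p))"
    unfolding f_def frac_p_integrand_def d_def powr_minus divide_inverse by simp
  have fall: "fall s x y = max 0 d powr (p - 1) * norm (x - y) powr (- (real CARD('n) + s * p))"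
    by (simp add: fall_def d_def)
  have rise: "rise s x y = max 0 (- d) powr (p - 1) * norm (x - y) powr (- (real CARD('n) + s * p))"
    by (simp add: rise_def d_def)
  consider "0 < d" | "d = 0" | "d < 0" by linarith
  then have "ennreal f = ennreal (fall s x y) \<and> ennreal (- f) = ennreal (rise s x y)"
  proof cases
    case 1
    then have "d * \<bar>d\<bar> powr (p - 2) = d powr (p - 1)"
      using powr_mult_base[of d "p - 2"] by simp
    then have "f = fall s x y" "rise s x y = 0"
      using 1 by (auto simp: f fall rise)
    then show ?thesis using fall_nonneg[of s x y] by (simp add: ennreal_neg)
  next
    case 2
    then show ?thesis by (simp add: f fall rise)
  next
    case 3
    then have "d * \<bar>d\<bar> powr (p - 2) = - ((- d) powr (p - 1))"
      using powr_mult_base[of "- d" "p - 2"] by simp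
    then have "- f = rise s x y" "fall s x y = 0"
      using 3 by (auto simp: f fall rise)
    then show ?thesis using rise_nonneg[of s x y] by (simp add: ennreal_neg)
  qed
  then show "ennreal f = ennreal (fall s x y)" "ennreal (- f) = ennreal (rise s x y)" by auto
qed

text \<open>Carries the sign of minus the operator, for which upper bounds are wanted. Both
  integrals are finite by \<open>tail_finite\<close>, so \<open>enn2real\<close> loses nothing where
  this is used.\<close>

definition truncated_integral :: "real \<Rightarrow> real^'n \<Rightarrow> real \<Rightarrow> real" where
  "truncated_integral s x \<epsilon> = enn2real (\<integral>\<^sup>+ y\<in>- ball x \<epsilon>. rise s x y \<partial>lborel)
    - enn2real (\<integral>\<^sup>+ y\<in>- ball x \<epsilon>. fall s x y \<partial>lborel)"

lemma has_extended_integral_truncated: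
  fixes x :: "real^'n"
  assumes s: "0 < s" "s < 1" and "0 < \<epsilon>"
  shows "has_extended_integral (lebesgue_on (- ball x \<epsilon>))
    (frac_p_integrand s p (\<lambda>y. profile (norm y) - 1) x) (ereal (- truncated_integral s x \<epsilon>))"
proof -
  have [simp]: "- ball x \<epsilon> \<in> sets borel" by (intro borel_closed) auto
  have "frac_p_integrand s p (\<lambda>y. profile (norm y) - 1) x \<in> borel_measurable borel"
    unfolding frac_p_integrand_def[abs_def] by measurable
  then have meas: "frac_p_integrand s p (\<lambda>y. profile (norm y) - 1) x \<in> borel_measurable (lebesgue_on (- ball x \<epsilon>))"
    by (intro measurable_restrict_space1 measurable_completion) simp
  obtain a where a: "(\<integral>\<^sup>+ y\<in>- ball x \<epsilon>. rise s x y \<partial>lborel) = ennreal a" "0 \<le> a"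
    using tail_finite(1)[OF assms, of x]
    unfolding infinity_ennreal_def less_top_ennreal by blast
  obtain b where b: "(\<integral>\<^sup>+ y\<in>- ball x \<epsilon>. fall s x y \<partial>lborel) = ennreal b" "0 \<le> b"
    using tail_finite(2)[OF assms, of x]
    unfolding infinity_ennreal_def less_top_ennreal by blast
  show ?thesis
    unfolding has_extended_integral_def
    using a b meas by (simp add: ennreal_frac_p_integrand nn_integral_lebesgue_on truncated_integral_def)
qed

lemma nn_integral_outside_ball_split:
  fixes x :: "'a::euclidean_space"
  assumes [measurable]: "f \<in> borel_measurable borel" and "\<epsilon> \<le> \<epsilon>'"
  shows "(\<integral>\<^sup>+ y\<in>- ball x \<epsilon>. f y \<partial>lborel) =
    (\<integral>\<^sup>+ y\<in>- ball x \<epsilon>'. f y \<partial>lborel) + (\<integral>\<^sup>+ y\<in>ball x \<epsilon>' - ball x \<epsilon>. f y \<partial>lborel)"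
proof -
  have [measurable]: "- ball x \<epsilon>' \<in> sets borel" "ball x \<epsilon>' - ball x \<epsilon> \<in> sets borel"
    by (auto intro: borel_closed)
  have "(\<integral>\<^sup>+ y\<in>- ball x \<epsilon>. f y \<partial>lborel) =
      (\<integral>\<^sup>+ y. (f y * indicator (- ball x \<epsilon>') y + f y * indicator (ball x \<epsilon>' - ball x \<epsilon>) y) \<partial>lborel)"
    using assms(2) by (intro nn_integral_cong) (auto simp: indicator_def)
  also have "\<dots> = (\<integral>\<^sup>+ y\<in>- ball x \<epsilon>'. f y \<partial>lborel) + (\<integral>\<^sup>+ y\<in>ball x \<epsilon>' - ball x \<epsilon>. f y \<partial>lborel)"
    by (rule nn_integral_add) measurable
  finally show ?thesis .
qed

lemma truncated_integral_le:
  fixes x :: "real^'n"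
  assumes s: "0 < s" "s < 1" and \<epsilon>: "0 < \<epsilon>" "\<epsilon> < \<epsilon>'" and "0 \<le> c"
    and le: "(\<integral>\<^sup>+ y\<in>ball x \<epsilon>' - ball x \<epsilon>. rise s x y \<partial>lborel)
      \<le> (\<integral>\<^sup>+ y\<in>ball x \<epsilon>' - ball x \<epsilon>. fall s x y \<partial>lborel) + ennreal c"
  shows "truncated_integral s x \<epsilon> \<le> truncated_integral s x \<epsilon>' + c"
proof -
  let ?U = "\<lambda>\<epsilon>. \<integral>\<^sup>+ y\<in>- ball x \<epsilon>. rise s x y \<partial>lborel" and ?F = "\<lambda>\<epsilon>. \<integral>\<^sup>+ y\<in>- ball x \<epsilon>. fall s x y \<partial>lborel"
  have \<epsilon>': "0 < \<epsilon>'" using \<epsilon> by simp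
  have "?U \<epsilon> = ?U \<epsilon>' + (\<integral>\<^sup>+ y\<in>ball x \<epsilon>' - ball x \<epsilon>. rise s x y \<partial>lborel)"
    using \<epsilon> by (intro nn_integral_outside_ball_split) auto
  \<comment> \<open>Adding \<open>?F \<epsilon>'\<close> turns the comparison of differences into
    one of sums, which is safe in \<open>ennreal\<close>; the subtraction takes place in the reals
    at the end.\<close>
  then have "?U \<epsilon> + ?F \<epsilon>' \<le> ?U \<epsilon>' + ((\<integral>\<^sup>+ y\<in>ball x \<epsilon>' - ball x \<epsilon>. fall s x y \<partial>lborel) + ennreal c) + ?F \<epsilon>'"
    using le by (simp add: add_left_mono add_right_mono)
  also have "\<dots> = ?U \<epsilon>' + ?F \<epsilon> + ennreal c"
    using \<epsilon> nn_integral_outside_ball_split[of "\<lambda>y. ennreal (fall s x y)" \<epsilon> \<epsilon>' x] by (simp add: ac_simps)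
  finally have *: "?U \<epsilon> + ?F \<epsilon>' \<le> ?U \<epsilon>' + ?F \<epsilon> + ennreal c" .
  have "enn2real (?U \<epsilon> + ?F \<epsilon>') \<le> enn2real (?U \<epsilon>' + ?F \<epsilon> + ennreal c)"
    using * tail_finite[OF s \<epsilon>(1), of x] tail_finite[OF s \<epsilon>', of x] by (intro enn2real_mono) auto
  then show ?thesis
    using tail_finite[OF s \<epsilon>(1), of x] tail_finite[OF s \<epsilon>', of x] \<open>0 \<le> c\<close>
    by (simp add: truncated_integral_def enn2real_plus)
qed

text \<open>The bound on annuli makes the truncated integrals almost monotone, so they converge in
  the extended reals.\<close>

lemma ex_frac_p_laplacian:
  fixes x :: "real^'n"
  assumes s: "0 < s" "s < 1" and "0 < \<delta>" and \<omega>: "(\<omega> \<longlongrightarrow> 0) (at_right 0)" and nonneg: "\<And>\<epsilon>. 0 \<le> \<omega> \<epsilon>"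
    and le: "\<And>\<epsilon> \<epsilon>'. 0 < \<epsilon> \<Longrightarrow> \<epsilon> < \<epsilon>' \<Longrightarrow> \<epsilon>' \<le> \<delta> \<Longrightarrow>
      (\<integral>\<^sup>+ y\<in>ball x \<epsilon>' - ball x \<epsilon>. rise s x y \<partial>lborel)
      \<le> (\<integral>\<^sup>+ y\<in>ball x \<epsilon>' - ball x \<epsilon>. fall s x y \<partial>lborel) + ennreal (\<omega> \<epsilon>')"
  shows "\<exists>L. has_frac_p_laplacian s p (\<lambda>y. profile (norm y) - 1) x L \<and>
    - L \<le> ereal (truncated_integral s x \<delta> + \<omega> \<delta>)"
proof -
  have "\<exists>L. ((\<lambda>\<epsilon>. ereal (truncated_integral s x \<epsilon>)) \<longlongrightarrow> L) (at_right 0) \<and>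
      L \<le> ereal (truncated_integral s x \<delta> + \<omega> \<delta>)"
    by (intro almost_monotone_tendsto[OF \<open>0 < \<delta>\<close> \<omega>] truncated_integral_le s nonneg le)
  then obtain L where L: "((\<lambda>\<epsilon>. ereal (truncated_integral s x \<epsilon>)) \<longlongrightarrow> L) (at_right 0)"
    "L \<le> ereal (truncated_integral s x \<delta> + \<omega> \<delta>)" by blast
  have "((\<lambda>\<epsilon>. ereal (- truncated_integral s x \<epsilon>)) \<longlongrightarrow> - L) (at_right 0)"
    using tendsto_uminus_ereal[OF L(1)] by simp
  then have "has_frac_p_laplacian s p (\<lambda>y. profile (norm y) - 1) x (- L)"
    unfolding has_frac_p_laplacian_def
    by (intro exI[of _ "\<lambda>\<epsilon>. ereal (- truncated_integral s x \<epsilon>)"] conjI allI impI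
        has_extended_integral_truncated s)
  then show ?thesis
    using L(2) by (intro exI[of _ "- L"]) simp
qed

section \<open>Upper bounds at saturated and at unsaturated points\<close>

lemma frac_p_laplacian_saturated:
  fixes x :: "real^'n"
  assumes s: "0 < s" "s < 1" and sat: "depth (norm x) \<le> R0"
  shows "\<exists>L. has_frac_p_laplacian s p (\<lambda>y. profile (norm y) - 1) x L \<and> - L \<le> 0"
proof -
  \<comment> \<open>At a saturated point the profile attains its maximum 2. The radius 1 below is
    arbitrary, and the error is 0.\<close>
  have rise: "rise s x y = 0" for y
    using profile_le_2[of "norm y"] profile_eq_2[OF sat] by (simp add: rise_def)
  have "\<exists>L. has_frac_p_laplacian s p (\<lambda>y. profile (norm y) - 1) x L \<and>
      - L \<le> ereal (truncated_integral s x 1 + 0)"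
    by (rule ex_frac_p_laplacian[OF s]) (auto simp: rise)
  moreover have "truncated_integral s x 1 \<le> 0"
    by (simp add: truncated_integral_def rise)
  then have "ereal (truncated_integral s x 1 + 0) \<le> 0" by simp
  ultimately show ?thesis by (meson order_trans)
qed

lemma frac_p_laplacian_unsaturated:
  fixes x :: "real^'n"
  assumes s: "0 < s" "s < 1" and D: "D = depth (norm x)" "R0 < D"
  shows "\<exists>L. has_frac_p_laplacian s p (\<lambda>y. profile (norm y) - 1) x L \<and>
    - L \<le> ereal (total_const CARD('n) * D powr (- (s * p)) / (s * (1 - s)))"
proof -
  let ?V = "volume_const CARD('n)" and ?C = "local_const CARD('n)"
  define \<omega> where "\<omega> \<epsilon> = ?C * D powr (- p) * (\<epsilon> powr (p * (1 - s)) / (1 - s))" for \<epsilon>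
  have Dp: "0 < D" using D R0 by simp
  have e: "0 < p * (1 - s)" using p s by simp
  have pos: "eventually (\<lambda>\<epsilon> :: real. 0 \<le> \<epsilon>) (at_right 0)"
    using eventually_at_right_less[of 0] by eventually_elim simp
  have "((\<lambda>\<epsilon> :: real. \<epsilon> powr (p * (1 - s))) \<longlongrightarrow> 0) (at_right 0)"
    using e pos by (intro tendsto_zero_powrI[OF tendsto_ident_at tendsto_const]) auto
  from tendsto_mult_left[OF tendsto_divide[OF this tendsto_const], of "1 - s" "?C * D powr (- p)"]
  have "(\<omega> \<longlongrightarrow> 0) (at_right 0)"
    using s by (simp add: \<omega>_def[abs_def])
  then have "\<exists>L. has_frac_p_laplacian s p (\<lambda>y. profile (norm y) - 1) x L \<and>
    - L \<le> ereal (truncated_integral s x (D / 2) + \<omega> (D / 2))"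
    using Dp s local_const_nonneg unfolding \<omega>_def
    by (intro ex_frac_p_laplacian rise_annulus_le[OF D]) auto
  \<comment> \<open>Cutting at \<open>D / 2\<close> gives both parts the power
    \<open>D powr (- (s * p))\<close>: the tail directly, the local error as
    \<open>D powr (- p) * D powr (p * (1 - s))\<close>. Both \<open>1 / s\<close> and
    \<open>1 / (1 - s)\<close> are at most \<open>1 / (s * (1 - s))\<close>.\<close>
  moreover have "truncated_integral s x (D / 2) + \<omega> (D / 2)
      \<le> total_const CARD('n) * D powr (- (s * p)) / (s * (1 - s))"
  proof -
    have pow2: "(D / 2) powr (- (s * p)) \<le> 2 powr p * D powr (- (s * p))"
    proof -
      have "(D / 2) powr (- (s * p)) = 2 powr (s * p) * D powr (- (s * p))"
        using Dp by (simp add: powr_divide powr_minus_divide)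
      moreover have "2 powr (s * p) \<le> (2 :: real) powr p"
        using s p by (intro powr_mono) (auto simp: mult_le_cancel_right1)
      ultimately show ?thesis by (simp add: mult_right_mono)
    qed
    have "enn2real (\<integral>\<^sup>+ y\<in>- ball x (D / 2). rise s x y \<partial>lborel)
        \<le> 2 powr (p - 1) * (?V * (D / 2) powr (- (s * p)) / s)"
      using finite_tail(1)[OF s, of "D / 2" x] Dp volume_const_nonneg s by (intro enn2real_leI) auto
    then have "truncated_integral s x (D / 2) \<le> 2 powr (p - 1) * (?V * (D / 2) powr (- (s * p)) / s)"
      by (simp add: truncated_integral_def add_increasing2 diff_le_eq)
    also have "\<dots> \<le> 2 powr p * (?V * (2 powr p * D powr (- (s * p))) / s)"
      using pow2 volume_const_nonneg s
      by (intro mult_mono divide_right_mono mult_left_mono powr_mono) auto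
    also have "\<dots> = 2 powr (2 * p) * ?V * D powr (- (s * p)) / s"
    proof -
      have "(2 :: real) powr (2 * p) = 2 powr p * 2 powr p"
        by (simp flip: powr_add)
      then show ?thesis by (simp only: mult_ac times_divide_eq_right)
    qed
    also have "\<dots> \<le> 2 powr (2 * p) * ?V * D powr (- (s * p)) / (s * (1 - s))"
      using s volume_const_nonneg by (intro divide_left_mono) (auto simp: mult_left_le)
    finally have 1: "truncated_integral s x (D / 2) \<le> 2 powr (2 * p) * ?V * D powr (- (s * p)) / (s * (1 - s))" .
    have "(D / 2) powr (p * (1 - s)) \<le> D powr (p * (1 - s))"
      using Dp e by (intro powr_mono2) auto
    then have "\<omega> (D / 2) \<le> ?C * D powr (- p) * (D powr (p * (1 - s)) / (1 - s))"
      unfolding \<omega>_def using s local_const_nonneg by (intro mult_left_mono divide_right_mono) auto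
    also have "\<dots> = ?C * (D powr (- p) * D powr (p * (1 - s))) / (1 - s)"
      by simp
    also have "D powr (- p) * D powr (p * (1 - s)) = D powr (- (s * p))"
      by (simp add: algebra_simps flip: powr_add)
    also have "?C * D powr (- (s * p)) / (1 - s) \<le> ?C * D powr (- (s * p)) / (s * (1 - s))"
      using s local_const_nonneg by (intro divide_left_mono) (auto simp: mult_left_le_one_le)
    finally have "\<omega> (D / 2) \<le> ?C * D powr (- (s * p)) / (s * (1 - s))" .
    with 1 show ?thesis
      by (simp add: total_const_def distrib_right add_divide_distrib)
  qed
  ultimately show ?thesis
    by (meson ereal_less_eq(3) order_trans)
qed

text \<open>At distance \<open>d \<le> max 1 Rb\<close> from the sphere,
  \<open>1 + d \<le> 2 * max 1 Rb\<close> and the bound 2 for the profile suffices. Farther inside,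
  \<open>1 + d \<le> 2 * d\<close> and the depth is at least \<open>d / \<beta>\<close>; the
  relation \<open>Rb = \<beta> * R0\<close> absorbs the \<open>\<beta>\<close>.\<close>

lemma profile_decay:
  assumes "0 \<le> r" "r < R" and \<alpha>q: "\<alpha> \<le> q" and Rb: "Rb = \<beta> * R0"
  shows "profile r \<le> 2 powr (q + 1) * max 1 (Rb powr \<alpha>) / (1 + R - r) powr \<alpha>"
proof -
  define d where "d = R - r"
  have d: "0 < d" using assms by (simp add: d_def)
  have Rb_pos: "0 < Rb" using Rb R0 \<beta>_gt_1 by simp
  have q: "2 * 2 powr \<alpha> \<le> (2 :: real) powr (q + 1)"
    using \<alpha>q by (simp add: powr_add)
  have "profile r * (1 + d) powr \<alpha> \<le> 2 powr (q + 1) * max 1 (Rb powr \<alpha>)"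
  proof (cases "d \<le> max 1 Rb")
    case True
    then have "1 + d \<le> 2 * max 1 Rb" by linarith
    then have "(1 + d) powr \<alpha> \<le> (2 * max 1 Rb) powr \<alpha>"
      using d \<alpha> by (intro powr_mono2) auto
    also have "\<dots> = 2 powr \<alpha> * max 1 Rb powr \<alpha>"
      by (rule powr_mult)
    also have "max 1 Rb powr \<alpha> \<le> max 1 (Rb powr \<alpha>)"
      by (auto simp: max_def)
    finally have *: "(1 + d) powr \<alpha> \<le> 2 powr \<alpha> * max 1 (Rb powr \<alpha>)"
      by (simp add: mult_left_mono)
    have "profile r * (1 + d) powr \<alpha> \<le> 2 * (2 powr \<alpha> * max 1 (Rb powr \<alpha>))"
      using profile_le_2 profile_pos * by (intro mult_mono) (auto simp: less_imp_le)
    also have "\<dots> \<le> 2 powr (q + 1) * max 1 (Rb powr \<alpha>)"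
      using q by (simp add: mult_right_mono flip: mult.assoc)
    finally show ?thesis .
  next
    case False
    have dd: "d / \<beta> \<le> depth r"
      using depth_ge[of r] assms by (simp add: d_def)
    have "R0 = Rb / \<beta>" using Rb \<beta>_gt_1 by simp
    also have "\<dots> \<le> d / \<beta>" using False \<beta>_gt_1 by (intro divide_right_mono) auto
    finally have R0d: "R0 \<le> d / \<beta>" .
    have "max R0 (depth r) = depth r" using R0d dd by simp
    then have "profile r = 2 * (R0 / depth r) powr \<alpha>"
      by (simp add: profile_def)
    also have "\<dots> \<le> 2 * (R0 / (d / \<beta>)) powr \<alpha>"
    proof -
      have "0 < d / \<beta>" using d \<beta>_gt_1 by simp
      then have "R0 / depth r \<le> R0 / (d / \<beta>)" "0 \<le> R0 / depth r"
        using dd R0 by (intro frac_le divide_nonneg_nonneg; linarith)+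
      then show ?thesis
        using \<alpha> by (intro mult_left_mono powr_mono2) auto
    qed
    also have "R0 / (d / \<beta>) = Rb / d" using Rb by (simp add: mult.commute)
    finally have "profile r * (1 + d) powr \<alpha> \<le> 2 * (Rb / d) powr \<alpha> * (2 * d) powr \<alpha>"
      using profile_pos[of r] d False \<alpha> by (intro mult_mono powr_mono2) (auto simp: less_imp_le)
    also have "\<dots> = 2 * 2 powr \<alpha> * Rb powr \<alpha>"
      using d Rb_pos by (simp add: powr_divide powr_mult)
    also have "\<dots> \<le> 2 powr (q + 1) * max 1 (Rb powr \<alpha>)"
      using q by (intro mult_mono) auto
    finally show ?thesis .
  qed
  then show ?thesis
    using d assms by (simp add: d_def le_divide_eq algebra_simps)
qed

end

section \<open>Choice of the constants and assembly of the barrier\<close>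

theorem theorem3p1:
  fixes p m :: real
  assumes "1 < p" and "p \<le> m"
  shows "\<exists>C>0. \<forall>\<tau>>0. \<forall>s. 0 < s \<and> s < 1 \<longrightarrow>
    (let R0 = (C / (s * (1 - s) * \<tau>)) powr (1 / (p * s));
         q = p / (m - 1);
         K = 2 powr (q + 1) * max 1 (R0 powr (q * s))
     in \<forall>R\<ge>R0. \<exists>w :: real ^ 'n \<Rightarrow> real.
          rotationally_symmetric w \<and>
          continuous_on UNIV w \<and>
          (\<forall>x. - 1 < w x \<and> w x \<le> 1) \<and>
          (\<forall>x. x \<notin> ball 0 R \<longrightarrow> w x = 1) \<and>
          (\<forall>x\<in>ball 0 R. \<exists>L. has_frac_p_laplacian s p w x L \<and>
             - L \<le> ereal (\<tau> * (1 + w x) powr (m - 1))) \<and>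
          (\<forall>x\<in>ball 0 R. 1 + w x \<le> K / (1 + R - norm x) powr (q * s)))"
proof -
  define b where "b = p / (p - 1)"
  \<comment> \<open>\<open>total_const\<close> depends only on \<open>p\<close> and the dimension;
    \<open>c\<close> is a positive upper bound for it.\<close>
  define c where "c = \<bar>radial_barrier.total_const p CARD('n)\<bar> + 1"
  \<comment> \<open>The factor \<open>b powr p\<close> pays for the division by \<open>b\<close> in
    \<open>r0\<close>, which costs only \<open>b powr (- (p * s))\<close>.\<close>
  define C where "C = b powr p * c"
  have b: "1 < b" using assms by (simp add: b_def)
  have c: "0 < c" by (simp add: c_def)
  have C: "0 < C" using b c by (simp add: C_def)
  have main: "\<exists>w :: real ^ 'n \<Rightarrow> real.
          rotationally_symmetric w \<and>
          continuous_on UNIV w \<and>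
          (\<forall>x. - 1 < w x \<and> w x \<le> 1) \<and>
          (\<forall>x. x \<notin> ball 0 R \<longrightarrow> w x = 1) \<and>
          (\<forall>x\<in>ball 0 R. \<exists>L. has_frac_p_laplacian s p w x L \<and>
             - L \<le> ereal (\<tau> * (1 + w x) powr (m - 1))) \<and>
          (\<forall>x\<in>ball 0 R. 1 + w x \<le> 2 powr (q + 1) * max 1 (Rb powr (q * s)) / (1 + R - norm x) powr (q * s))"
    if \<tau>: "0 < \<tau>" and s: "0 < s" "s < 1" and q: "q = p / (m - 1)"
      and Rb: "Rb = (C / (s * (1 - s) * \<tau>)) powr (1 / (p * s))" and R: "Rb \<le> R" for \<tau> s q Rb R
  proof -
    have Rb_pos: "0 < Rb" using C s \<tau> by (simp add: Rb)
    have q_pos: "0 < q" using assms by (simp add: q)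
    have qb: "q \<le> b" unfolding q b_def using assms by (intro divide_left_mono) auto
    have qs: "q * s \<le> q" using q_pos s by (simp add: mult_left_le)
    define r0 where "r0 = Rb / b"
    interpret radial_barrier p R r0 "q * s"
      using assms Rb_pos R b q_pos s order_trans[OF qs qb] by unfold_locales (auto simp: r0_def b_def[symmetric])
    have \<beta>: "\<beta> = b" by (simp add: \<beta>_def b_def)
    define w where "w = (\<lambda>x :: real^'n. profile (norm x) - 1)"
    have "rotationally_symmetric w"
      unfolding rotationally_symmetric_def w_def by (rule exI[of _ "\<lambda>r. profile r - 1"]) simp
    moreover have "continuous_on UNIV w"
      unfolding w_def
      by (intro continuous_intros continuous_on_compose2[OF continuous_on_profile]) auto
    moreover have "- 1 < w x \<and> w x \<le> 1" for x
      using profile_pos[of "norm x"] profile_le_2[of "norm x"] by (simp add: w_def)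
    moreover have "w x = 1" if "x \<notin> ball 0 R" for x
      using that depth_nonpos[of "norm x"] R0 profile_eq_2[of "norm x"] by (simp add: w_def)
    moreover have "\<exists>L. has_frac_p_laplacian s p w x L \<and> - L \<le> ereal (\<tau> * (1 + w x) powr (m - 1))" for x
    proof (cases "depth (norm x) \<le> r0")
      case True
      then obtain L where L: "has_frac_p_laplacian s p w x L" "- L \<le> 0"
        using frac_p_laplacian_saturated[OF s, of x] by (auto simp: w_def)
      have "(0 :: ereal) \<le> ereal (\<tau> * (1 + w x) powr (m - 1))"
        using \<tau> by simp
      then show ?thesis using L order_trans by blast
    next
      case False
      define D where "D = depth (norm x)"
      have D: "r0 < D" "0 < D" using False R0 by (auto simp: D_def)
      then obtain L where L: "has_frac_p_laplacian s p w x L"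
        "- L \<le> ereal (total_const CARD('n) * D powr (- (s * p)) / (s * (1 - s)))"
        using frac_p_laplacian_unsaturated[OF s D_def D(1)] by (auto simp: w_def)
      have "total_const CARD('n) * D powr (- (s * p)) / (s * (1 - s)) \<le> \<tau> * (1 + w x) powr (m - 1)"
      proof -
        \<comment> \<open>The purpose of the exponent \<open>q\<close>: the right side of the
          inequality gets the same power of the depth as the bound for the operator.\<close>
        have ms: "q * s * (m - 1) = p * s" using assms by (simp add: q)
        have "1 + w x = 2 * (r0 / D) powr (q * s)"
          using D by (simp add: w_def profile_def flip: D_def)
        then have "(1 + w x) powr (m - 1) = 2 powr (m - 1) * (r0 / D) powr (p * s)"
          by (simp only: powr_mult powr_powr ms)
        also have "\<dots> \<ge> 1 * (r0 / D) powr (p * s)"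
          using assms by (intro mult_right_mono ge_one_powr_ge_zero) auto
        finally have 1: "(r0 / D) powr (p * s) \<le> (1 + w x) powr (m - 1)" by simp
        have "(r0 / D) powr (p * s) = Rb powr (p * s) * (b powr (- (p * s)) * D powr (- (s * p)))"
          using Rb_pos b D by (simp add: r0_def powr_divide powr_minus_divide powr_mult mult.commute)
        also have "Rb powr (p * s) = C / (s * (1 - s) * \<tau>)"
          using C s \<tau> assms by (simp add: Rb powr_powr)
        finally have 2: "\<tau> * (r0 / D) powr (p * s) =
            c * (b powr p * b powr (- (p * s))) * D powr (- (s * p)) / (s * (1 - s))"
          using \<tau> s by (simp add: C_def)
        have "1 \<le> b powr (p - p * s)"
          using b s assms by (intro ge_one_powr_ge_zero) (auto simp: mult_left_le)
        also have "\<dots> = b powr p * b powr (- (p * s))"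
          by (simp flip: powr_add)
        finally have "c * 1 \<le> c * (b powr p * b powr (- (p * s)))"
          using c by (intro mult_left_mono) auto
        then have "total_const CARD('n) \<le> c * (b powr p * b powr (- (p * s)))"
          by (simp add: c_def)
        then have "total_const CARD('n) * D powr (- (s * p)) / (s * (1 - s))
            \<le> c * (b powr p * b powr (- (p * s))) * D powr (- (s * p)) / (s * (1 - s))"
          using s by (intro divide_right_mono mult_right_mono) auto
        also have "\<dots> = \<tau> * (r0 / D) powr (p * s)"
          by (rule 2[symmetric])
        also have "\<dots> \<le> \<tau> * (1 + w x) powr (m - 1)"
          using 1 \<tau> by (intro mult_left_mono) auto
        finally show ?thesis .
      qed
      then show ?thesis using L order_trans ereal_less_eq(3) by blast
    qed
    moreover have "1 + w x \<le> 2 powr (q + 1) * max 1 (Rb powr (q * s)) / (1 + R - norm x) powr (q * s)"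
      if "x \<in> ball 0 R" for x
    proof -
      have "Rb = \<beta> * r0" using b by (simp add: \<beta> r0_def)
      then show ?thesis
        using profile_decay[of "norm x" q Rb] that qs by (simp add: w_def)
    qed
    ultimately show ?thesis
      by (intro exI[of _ w]) auto
  qed
  show ?thesis
    unfolding Let_def by (rule exI[of _ C]) (use C main in auto)
qed

end
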